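(* Let $X_1,\dots,X_n$ be i.i.d. from a semiparametric model with true parameter $(\theta_0,\eta_0)$, let $\widehat S_n(\theta)=\sum_{i=1}^n\log lik(X_i;\theta,\widehat\eta(\theta))$ be the (three times differentiable) generalized profile log-likelihood and $\widehat\theta_n=\arg\sup_{\theta\in\Theta}\widehat S_n(\theta)$. Suppose that Condition G (stated in the context), with exponent $1/4<g\le1/2$, holds, that $\widehat\theta_n$ is consistent, and that $\widetilde I_0$ is nonsingular. Then $$\sqrt n(\widehat\theta_n-\theta_0)=\frac1{\sqrt n}\sum_{i=1}^n\widetilde I_0^{-1}\widetilde\ell_0(X_i)+O_P(n^{1/2-2g}).$$ Let $\widehat\theta_n^{(0)}$ be $n^\psi$-consistent (that is, $\|\widehat\theta_n^{(0)}-\theta_0\|=O_P(n^{-\psi})$) for some $1/2-g<\psi\le1/2$, and for $k\ge1$ let $$\widehat\theta_n^{(k)}=\widehat\theta_n^{(k-1)}+\big[\widehat I_n(\widehat\theta_n^{(k-1)})\big]^{-1}\widehat\ell_n(\widehat\theta_n^{(k-1)}),\qquad \widehat\ell_n(\theta)=\widehat S_n^{(1)}(\theta)/n,$$ where $\widehat I_n$ is given by one of the two constructions: (I) $\widehat I_n(\theta)=-\widehat S_n^{(2)}(\theta)/n$; (II) $[\widehat I_n(\theta)]_{ij}=-n^{-1/2}\dfrac{[\widehat S_n^{(1)}(\theta+n^{-1/2}t_2v_j)]_i-[\widehat S_n^{(1)}(\theta+n^{-1/2}t_1v_j)]_i}{t_2-t_1}$ for arbitrary fixed real numbers $t_1<t_2$.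 Write $\|\widehat\theta_n^{(k)}-\widehat\theta_n\|=O_P(n^{-r_k})$. Then $r_k$ increases from $\psi$ to $\infty$ as $k\to\infty$. Specifically, $$\|\widehat\theta_n^{(k)}-\widehat\theta_n\|=O_P(n^{-2^k\psi})\ \text{ under construction (I)},$$ $$\|\widehat\theta_n^{(k)}-\widehat\theta_n\|=O_P(n^{-R(\psi,g,k)})\ \text{ under construction (II)},$$ where $$R(\psi,g,k)=\begin{cases}R_1(\psi,g,k)& k\le L_1(\psi,g)\\ R_2\big(R_1(\psi,g,L_1(\psi,g)),g,k-L_1(\psi,g)\big)& k>L_1(\psi,g),\end{cases}$$ with $R_1(\psi,g,k)=(1/2-g)+2^k(\psi+g-1/2)$, $R_2(\psi,g,k)=kg+\psi$ and $L_1(\psi,g)=int\big[\log\{g/(g+\psi-1/2)\}/\log2\big]$. This implies that $$\|\widehat\theta_n^{(k^\ast)}-\widehat\theta_n\|=o_P(n^{-1/2}),$$ where $k^\ast=\widetilde{int}\big[\log\{1/(2\psi)\}/\log2\big]$ under construction (I) and $k^\ast=\widetilde L_1(\psi,g)=\widetilde{int}\big[\log\{g/(g+\psi-1/2)\}/\log2\big]$ under construction (II).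
   Context: Notation. $int[x]$ and $\widetilde{int}[x]$ are the smallest nonnegative integers $\ge x$ and $>x$, respectively. $v_j$ is the $j$-th unit vector in $\mathbb R^d$; a superscript $(j)$ on a function of $\theta$ denotes its $j$-th derivative; $\mathcal N(\theta_0)$ is a neighborhood of $\theta_0$ in $\mathbb R^d$. $E$ denotes expectation at the true parameter $(\theta_0,\eta_0)$. Setting. The model is indexed by $\theta\in\Theta\subset\mathbb R^d$ and an infinite-dimensional nuisance parameter $\eta\in\mathcal H$, with one-observation log-likelihood $\log lik(X;\theta,\eta)$. The least favorable curve is $\eta_\ast(t)=\arg\sup_{\eta\in\mathcal H}E\log lik(X;t,\eta)$, with $\eta_\ast(\theta_0)=\eta_0$. The efficient score $\widetilde\ell_0$ is the residual of the $L_2$-projection of the score for $\theta$ at $(\theta_0,\eta_0)$ onto the closed linear span of the nuisance scores, and $\widetilde I_0$ is its covariance matrix. The least favorable submodel satisfies $$\frac{\partial}{\partial t}\Big|_{t=\theta_0}\log lik(X;t,\eta_\ast(t))=\widetilde\ell_0(X),\qquad \widetilde I_0=-E\Big(\frac{\partial^2}{\partial t^2}\Big|_{t=\theta_0}\log lik(X;t,\eta_\ast(t))\Big).$$ For each $\theta$, $\widehat\eta(\theta)$ is an estimator of $\eta_\ast(\theta)$. Put $S_n(\theta)=\sum_{i=1}^n\log lik(X_i;\theta,\eta_\ast(\theta))$. Condition G. For some $1/4<g\le1/2$, $$\tfrac1n\widehat S_n^{(1)}(\theta_0)-\tfrac1nS_n^{(1)}(\theta_0)=O_P(n^{-2g}),$$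 $$\sup_{\theta\in\mathcal N(\theta_0)}\Big|\tfrac1n\widehat S_n^{(2)}(\theta)-\tfrac1nS_n^{(2)}(\theta)\Big|=O_P(n^{-g}),\qquad \sup_{\theta\in\mathcal N(\theta_0)}\Big|\tfrac1n\widehat S_n^{(3)}(\theta)\Big|=O_P(1).$$
   Formalization: The first claim (the expansion of √n(θ̂_n−θ_0)) additionally assumes that the second derivative at θ_0 of log lik(X;t,η_*(t)) has a finite second moment; without it the O_P(n^{1/2−2g}) remainder can fail. The iteration claims do not need it. *)

theory Defs
  imports "HOL-Probability.Probability"
begin

section \<open>Stochastic order symbols\<close>

text \<open>
  Probabilities are outer probabilities, as usual for suprema over uncountable sets and for
  maximizers that need not be measurable; for measurable \<open>Z\<close> these are the standard notions
  (see \<open>outer_measure_of_eq\<close>). \<open>Z\<close> is \<open>ereal\<close>-valued so that an infinite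
  supremum counts as exceeding every bound.
\<close>

definition O_P :: "'w measure \<Rightarrow> (nat \<Rightarrow> 'w \<Rightarrow> ereal) \<Rightarrow> (nat \<Rightarrow> real) \<Rightarrow> bool" where
  "O_P M Z r \<longleftrightarrow> (\<forall>\<epsilon>>0. \<exists>C::real. \<forall>\<^sub>F n in sequentially.
     outer_measure_of M {\<omega> \<in> space M. ereal (C * r n) < Z n \<omega>} \<le> ennreal \<epsilon>)"

definition o_P :: "'w measure \<Rightarrow> (nat \<Rightarrow> 'w \<Rightarrow> ereal) \<Rightarrow> (nat \<Rightarrow> real) \<Rightarrow> bool" where
  "o_P M Z r \<longleftrightarrow> (\<forall>c::real>0.
     (\<lambda>n. outer_measure_of M {\<omega> \<in> space M. ereal (c * r n) < Z n \<omega>}) \<longlonglongrightarrow> 0)"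


section \<open>Derivatives of functions on \<open>\<real>\<^sup>d\<close>\<close>

definition grad :: "(real ^ 'd \<Rightarrow> real) \<Rightarrow> real ^ 'd \<Rightarrow> real ^ 'd::finite" where
  "grad f \<theta> = (\<chi> i. frechet_derivative f (at \<theta>) (axis i 1))"

text \<open>Entry \<open>(i, j)\<close> of \<open>hess f \<theta>\<close> is the derivative of \<open>grad f \<theta> $ i\<close> in direction \<open>j\<close>.\<close>

definition hess :: "(real ^ 'd \<Rightarrow> real) \<Rightarrow> real ^ 'd \<Rightarrow> real ^ 'd ^ 'd::finite" where
  "hess f \<theta> = jacobian (grad f) (at \<theta>)"

text \<open>The third derivative as a linear map into matrices, measured below by its operator norm.\<close>

definition third :: "(real ^ 'd \<Rightarrow> real) \<Rightarrow> real ^ 'd \<Rightarrow> real ^ 'd \<Rightarrow> real ^ 'd ^ 'd::finite" where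
  "third f \<theta> = frechet_derivative (hess f) (at \<theta>)"

definition twice_differentiable :: "(real ^ 'd::finite \<Rightarrow> real) \<Rightarrow> real ^ 'd \<Rightarrow> bool" where
  "twice_differentiable f \<theta> \<longleftrightarrow> f differentiable (at \<theta>) \<and> grad f differentiable (at \<theta>)"

definition thrice_differentiable :: "(real ^ 'd::finite \<Rightarrow> real) \<Rightarrow> real ^ 'd \<Rightarrow> bool" where
  "thrice_differentiable f \<theta> \<longleftrightarrow> twice_differentiable f \<theta> \<and> hess f differentiable (at \<theta>)"


section \<open>Semiparametric models\<close>

text \<open>
  \<open>lik \<theta> \<eta>\<close> is the likelihood of one observation: for parameters in the model it is a probability
  density with respect to \<open>\<mu>\<close>. It may vanish, and then \<open>ln (lik \<theta> \<eta> x)\<close> does not represent the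
  log-likelihood, which is \<open>-\<infinity>\<close>; hence the positivity side conditions below. Nothing is required
  of \<open>lik\<close> outside the model, so estimators of \<open>\<eta>\<close> may take values outside \<open>H\<close>.
\<close>

definition model_measure ::
  "'x measure \<Rightarrow> (real ^ 'd \<Rightarrow> 'h \<Rightarrow> 'x \<Rightarrow> real) \<Rightarrow> real ^ 'd::finite \<Rightarrow> 'h \<Rightarrow> 'x measure" where
  "model_measure \<mu> lik \<theta> \<eta> = density \<mu> (\<lambda>x. ennreal (lik \<theta> \<eta> x))"

definition semiparametric_model ::
  "'x measure \<Rightarrow> (real ^ 'd::finite \<Rightarrow> 'h \<Rightarrow> 'x \<Rightarrow> real) \<Rightarrow> (real ^ 'd) set \<Rightarrow> 'h set \<Rightarrow> bool" where
  "semiparametric_model \<mu> lik \<Theta> H \<longleftrightarrow> (\<forall>\<theta>\<in>\<Theta>. \<forall>\<eta>\<in>H.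
     lik \<theta> \<eta> \<in> borel_measurable \<mu> \<and> (\<forall>x\<in>space \<mu>. 0 \<le> lik \<theta> \<eta> x) \<and>
     prob_space (model_measure \<mu> lik \<theta> \<eta>))"

definition finite_E_loglik :: "'x measure \<Rightarrow> ('x \<Rightarrow> real) \<Rightarrow> bool" where
  "finite_E_loglik P0 l \<longleftrightarrow> (AE x in P0. 0 < l x) \<and> integrable P0 (\<lambda>x. ln (l x))"

text \<open>
  \<open>\<eta>s t\<close> maximizes the expected log-likelihood over \<open>\<eta> \<in> H\<close>. Values of \<open>\<eta>\<close> without finite
  expectation are no competitors: as \<open>\<eta>s \<theta>0 = \<eta>0\<close>, the log-likelihood at the truth is integrable,
  and \<open>ln u \<le> u\<close> applied to likelihood ratios shows that the expectation there is \<open>-\<infinity>\<close>.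
\<close>

definition least_favorable_curve ::
  "'x measure \<Rightarrow> (real ^ 'd::finite \<Rightarrow> 'h \<Rightarrow> 'x \<Rightarrow> real) \<Rightarrow> (real ^ 'd) set \<Rightarrow> 'h set \<Rightarrow>
   real ^ 'd \<Rightarrow> 'h \<Rightarrow> (real ^ 'd \<Rightarrow> 'h) \<Rightarrow> bool" where
  "least_favorable_curve \<mu> lik \<Theta> H \<theta>0 \<eta>0 \<eta>s \<longleftrightarrow>
     (let P0 = model_measure \<mu> lik \<theta>0 \<eta>0 in
       \<eta>s \<theta>0 = \<eta>0 \<and>
       (\<forall>t\<in>\<Theta>. \<eta>s t \<in> H \<and> finite_E_loglik P0 (lik t (\<eta>s t)) \<and>
         (\<forall>\<eta>\<in>H. finite_E_loglik P0 (lik t \<eta>) \<longrightarrow>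
            (\<integral>x. ln (lik t \<eta> x) \<partial>P0) \<le> (\<integral>x. ln (lik t (\<eta>s t) x) \<partial>P0))))"


section \<open>Scores, efficient score and efficient information\<close>

definition L2 :: "'x measure \<Rightarrow> ('x \<Rightarrow> real) set" where
  "L2 P = {f \<in> borel_measurable P. integrable P (\<lambda>x. (f x)\<^sup>2)}"

definition L2_0 :: "'x measure \<Rightarrow> ('x \<Rightarrow> real) set" where
  "L2_0 P = {f \<in> L2 P. (\<integral>x. f x \<partial>P) = 0}"

text \<open>Scores are centred and square integrable, as the tangent functions of regular submodels are.\<close>

definition is_theta_score ::
  "'x measure \<Rightarrow> (real ^ 'd::finite \<Rightarrow> 'h \<Rightarrow> 'x \<Rightarrow> real) \<Rightarrow> real ^ 'd \<Rightarrow> 'h \<Rightarrow>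
   ('x \<Rightarrow> real ^ 'd) \<Rightarrow> bool" where
  "is_theta_score \<mu> lik \<theta>0 \<eta>0 s \<longleftrightarrow>
     (let P0 = model_measure \<mu> lik \<theta>0 \<eta>0 in
       (\<forall>i. (\<lambda>x. s x $ i) \<in> L2_0 P0) \<and>
       (AE x in P0. (\<forall>\<^sub>F \<theta> in nhds \<theta>0. 0 < lik \<theta> \<eta>0 x) \<and>
                    GDERIV (\<lambda>\<theta>. ln (lik \<theta> \<eta>0 x)) \<theta>0 :> s x))"

definition nuisance_scores ::
  "'x measure \<Rightarrow> (real ^ 'd::finite \<Rightarrow> 'h \<Rightarrow> 'x \<Rightarrow> real) \<Rightarrow> 'h set \<Rightarrow> real ^ 'd \<Rightarrow> 'h \<Rightarrow>
   ('x \<Rightarrow> real) set" where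
  "nuisance_scores \<mu> lik H \<theta>0 \<eta>0 =
     (let P0 = model_measure \<mu> lik \<theta>0 \<eta>0 in
       {s \<in> L2_0 P0. \<exists>\<gamma>::real \<Rightarrow> 'h. \<gamma> 0 = \<eta>0 \<and> (\<forall>\<^sub>F t in nhds 0. \<gamma> t \<in> H) \<and>
          (AE x in P0. (\<forall>\<^sub>F t in nhds 0. 0 < lik \<theta>0 (\<gamma> t) x) \<and>
                       ((\<lambda>t. ln (lik \<theta>0 (\<gamma> t) x)) has_real_derivative s x) (at 0))})"

definition closed_linear_span :: "'x measure \<Rightarrow> ('x \<Rightarrow> real) set \<Rightarrow> ('x \<Rightarrow> real) set" where
  "closed_linear_span P A = {f \<in> L2 P. \<forall>\<epsilon>>0. \<exists>F c. finite F \<and> F \<subseteq> A \<and>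
     (\<integral>x. (f x - (\<Sum>s\<in>F. c s * s x))\<^sup>2 \<partial>P) < \<epsilon>}"

definition is_L2_projection ::
  "'x measure \<Rightarrow> ('x \<Rightarrow> real) set \<Rightarrow> ('x \<Rightarrow> real) \<Rightarrow> ('x \<Rightarrow> real) \<Rightarrow> bool" where
  "is_L2_projection P V f p \<longleftrightarrow>
     p \<in> V \<and> (\<forall>g\<in>V. (\<integral>x. (f x - p x)\<^sup>2 \<partial>P) \<le> (\<integral>x. (f x - g x)\<^sup>2 \<partial>P))"

definition is_efficient_score ::
  "'x measure \<Rightarrow> (real ^ 'd::finite \<Rightarrow> 'h \<Rightarrow> 'x \<Rightarrow> real) \<Rightarrow> 'h set \<Rightarrow> real ^ 'd \<Rightarrow> 'h \<Rightarrow>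
   ('x \<Rightarrow> real ^ 'd) \<Rightarrow> bool" where
  "is_efficient_score \<mu> lik H \<theta>0 \<eta>0 ell \<longleftrightarrow>
     (let P0 = model_measure \<mu> lik \<theta>0 \<eta>0 in
       ell \<in> borel_measurable P0 \<and>
       (\<exists>s p. is_theta_score \<mu> lik \<theta>0 \<eta>0 s \<and>
          (\<forall>i. is_L2_projection P0 (closed_linear_span P0 (nuisance_scores \<mu> lik H \<theta>0 \<eta>0))
                 (\<lambda>x. s x $ i) (\<lambda>x. p x $ i)) \<and>
          (AE x in P0. ell x = s x - p x)))"

definition covariance_matrix :: "'x measure \<Rightarrow> ('x \<Rightarrow> real ^ 'd) \<Rightarrow> real ^ 'd ^ 'd::finite" where
  "covariance_matrix P f =
     (\<chi> i j. \<integral>x. (f x $ i - (\<integral>y. f y $ i \<partial>P)) * (f x $ j - (\<integral>y. f y $ j \<partial>P)) \<partial>P)"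


section \<open>Profile log-likelihoods\<close>

text \<open>
  The log-likelihood of the observations \<open>X 0 \<omega>, \<dots>, X (n - 1) \<omega>\<close> along the curve
  \<open>\<theta> \<mapsto> (\<theta>, \<eta> \<theta>)\<close>, to be read as \<open>-\<infinity>\<close> unless \<open>lik_pos\<close> holds.
\<close>

definition loglik_sum ::
  "(real ^ 'd::finite \<Rightarrow> 'h \<Rightarrow> 'x \<Rightarrow> real) \<Rightarrow> (nat \<Rightarrow> 'w \<Rightarrow> 'x) \<Rightarrow> nat \<Rightarrow> 'w \<Rightarrow>
   (real ^ 'd \<Rightarrow> 'h) \<Rightarrow> real ^ 'd \<Rightarrow> real" where
  "loglik_sum lik X n \<omega> \<eta> \<theta> = (\<Sum>i<n. ln (lik \<theta> (\<eta> \<theta>) (X i \<omega>)))"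

definition lik_pos ::
  "(real ^ 'd::finite \<Rightarrow> 'h \<Rightarrow> 'x \<Rightarrow> real) \<Rightarrow> (nat \<Rightarrow> 'w \<Rightarrow> 'x) \<Rightarrow> nat \<Rightarrow> 'w \<Rightarrow>
   (real ^ 'd \<Rightarrow> 'h) \<Rightarrow> real ^ 'd \<Rightarrow> bool" where
  "lik_pos lik X n \<omega> \<eta> \<theta> \<longleftrightarrow> (\<forall>i<n. 0 < lik \<theta> (\<eta> \<theta>) (X i \<omega>))"

definition is_profile_maximizer ::
  "(real ^ 'd::finite \<Rightarrow> 'h \<Rightarrow> 'x \<Rightarrow> real) \<Rightarrow> (nat \<Rightarrow> 'w \<Rightarrow> 'x) \<Rightarrow> nat \<Rightarrow> 'w \<Rightarrow>
   (real ^ 'd \<Rightarrow> 'h) \<Rightarrow> (real ^ 'd) set \<Rightarrow> real ^ 'd \<Rightarrow> bool" where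
  "is_profile_maximizer lik X n \<omega> \<eta> \<Theta> \<theta>' \<longleftrightarrow>
     is_arg_max (loglik_sum lik X n \<omega> \<eta>) (\<lambda>\<theta>. \<theta> \<in> \<Theta> \<and> lik_pos lik X n \<omega> \<eta> \<theta>) \<theta>'"


section \<open>The iterative scheme\<close>

text \<open>Below \<open>S\<close> is a realization of the generalized profile log-likelihood of \<open>n\<close> observations.\<close>

definition ell_hat :: "nat \<Rightarrow> (real ^ 'd \<Rightarrow> real) \<Rightarrow> real ^ 'd \<Rightarrow> real ^ 'd::finite" where
  "ell_hat n S \<theta> = grad S \<theta> /\<^sub>R real n"

definition I_hat_hess :: "nat \<Rightarrow> (real ^ 'd \<Rightarrow> real) \<Rightarrow> real ^ 'd \<Rightarrow> real ^ 'd ^ 'd::finite" where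
  "I_hat_hess n S \<theta> = - (hess S \<theta> /\<^sub>R real n)"

definition I_hat_diff ::
  "real \<Rightarrow> real \<Rightarrow> nat \<Rightarrow> (real ^ 'd \<Rightarrow> real) \<Rightarrow> real ^ 'd \<Rightarrow> real ^ 'd ^ 'd::finite" where
  "I_hat_diff t1 t2 n S \<theta> = (\<chi> i j. - (real n powr (-1/2)) *
     (grad S (\<theta> + (real n powr (-1/2) * t2) *\<^sub>R axis j 1) $ i
      - grad S (\<theta> + (real n powr (-1/2) * t1) *\<^sub>R axis j 1) $ i) / (t2 - t1))"

text \<open>
  \<open>matrix_inv\<close> is unspecified on singular matrices; this only concerns events of vanishing
  probability.
\<close>

definition iterate ::
  "(nat \<Rightarrow> (real ^ 'd \<Rightarrow> real) \<Rightarrow> real ^ 'd \<Rightarrow> real ^ 'd ^ 'd) \<Rightarrow>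
   nat \<Rightarrow> (real ^ 'd \<Rightarrow> real) \<Rightarrow> real ^ 'd \<Rightarrow> nat \<Rightarrow> real ^ 'd::finite" where
  "iterate Ihat n S \<theta>init k =
     ((\<lambda>\<theta>. \<theta> + matrix_inv (Ihat n S \<theta>) *v ell_hat n S \<theta>) ^^ k) \<theta>init"


section \<open>Rates\<close>

definition int_ge :: "real \<Rightarrow> nat" where
  "int_ge x = (LEAST m. x \<le> real m)"

definition int_gt :: "real \<Rightarrow> nat" where
  "int_gt x = (LEAST m. x < real m)"

definition R1 :: "real \<Rightarrow> real \<Rightarrow> nat \<Rightarrow> real" where
  "R1 \<psi> g k = (1/2 - g) + 2 ^ k * (\<psi> + g - 1/2)"

definition R2 :: "real \<Rightarrow> real \<Rightarrow> nat \<Rightarrow> real" where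
  "R2 \<psi> g k = real k * g + \<psi>"

definition L1 :: "real \<Rightarrow> real \<Rightarrow> nat" where
  "L1 \<psi> g = int_ge (ln (g / (g + \<psi> - 1/2)) / ln 2)"

definition L1_tilde :: "real \<Rightarrow> real \<Rightarrow> nat" where
  "L1_tilde \<psi> g = int_gt (ln (g / (g + \<psi> - 1/2)) / ln 2)"

definition R :: "real \<Rightarrow> real \<Rightarrow> nat \<Rightarrow> real" where
  "R \<psi> g k = (if k \<le> L1 \<psi> g then R1 \<psi> g k else R2 (R1 \<psi> g (L1 \<psi> g)) g (k - L1 \<psi> g))"

definition increases_to_infinity_from :: "(nat \<Rightarrow> real) \<Rightarrow> real \<Rightarrow> bool" where
  "increases_to_infinity_from r a \<longleftrightarrow> r 0 = a \<and> strict_mono r \<and> filterlim r at_top sequentially"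

end

theory Submission
  imports Defs
begin

text \<open>
  Write \<open>l = grad Shat / n\<close> and \<open>H = hess Shat / n\<close>. Condition G bounds the third derivative, so with
  probability tending to one \<open>H\<close> is Lipschitz near \<open>\<theta>0\<close> with a constant \<open>\<Lambda> = O_P(1)\<close>, and the weak
  law gives \<open>H \<theta>0 \<longlonglongrightarrow> - I0\<close>. Since \<open>l\<close> vanishes at the maximizer, linearizing \<open>l\<close> at \<open>\<theta>0\<close> first shows
  that \<open>\<theta>hat\<close> is root-n-consistent and then gives the expansion, the error terms being
  \<open>\<Lambda> |\<theta>hat - \<theta>0|\<^sup>2\<close>, \<open>|H \<theta>0 + I0| |\<theta>hat - \<theta>0|\<close> and the difference of the two scores at \<open>\<theta>0\<close>. Linearizing
  at the current iterate shows that one step turns the error \<open>d\<close> into at most a constant times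
  \<open>\<Lambda> d\<^sup>2 + |Ihat + H| d\<close>. The second term vanishes under construction (I) and is \<open>O_P(n powr (-1/2)) d\<close> under
  construction (II), so a rate \<open>r\<close> improves to \<open>2 * r\<close>, respectively \<open>min (2 * r) (r + 1/2)\<close>; the
  sequence \<open>R \<psi> g\<close> never increases faster than this.
\<close>

section \<open>Outer probability and stochastic orders\<close>

text \<open>Maximizers, iterates and suprema need not be measurable. Hence each stochastic statement
  is an inequality that holds off a bad set, and bad sets are united by subadditivity of the outer
  measure. Moments enter only through sums over the observations. The remainder \<Lambda>
  |\<theta>hat - \<theta>0|^2 contains the very rate that is sought. Consistency breaks the circle:
  \<Lambda> |\<theta>hat - \<theta>0| is o_P(1), so the linear term, bounded below because
  \<open>I0\<close> is nonsingular, absorbs the remainder. For inverting H it is enough that H is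
  close to - \<open>I0\<close>. The expansion asks for more: |H \<theta>0 + I0| |\<theta>hat -
  \<theta>0| must be O_P(n powr (-2 g)), which takes a rate for H \<theta>0 + I0 itself, and the
  weak law provides none. Condition G gives n powr (-g) for the difference of the two Hessians; the
  square integrability of the entries of \<open>hess (lfs x) \<theta>0\<close>, the antecedent of
  the first claim, gives n powr (-1/2) for the sample average.\<close>

definition whp :: "'w measure \<Rightarrow> (nat \<Rightarrow> 'w \<Rightarrow> bool) \<Rightarrow> bool" where
  "whp M E \<longleftrightarrow> (\<lambda>n. outer_measure_of M {\<omega> \<in> space M. \<not> E n \<omega>}) \<longlonglongrightarrow> 0"

text \<open>Each set has a measurable cover of the same outer measure, which reduces the claim to
  subadditivity of the measure.\<close>

lemma outer_measure_of_Un_le: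
  assumes "A \<subseteq> space M" "B \<subseteq> space M"
  shows "outer_measure_of M (A \<union> B) \<le> outer_measure_of M A + outer_measure_of M B"
proof -
  obtain A' where A': "A' \<in> sets M" "A \<subseteq> A'" "outer_measure_of M A = emeasure M A'"
    using outer_measure_of_attain[OF assms(1)] by blast
  obtain B' where B': "B' \<in> sets M" "B \<subseteq> B'" "outer_measure_of M B = emeasure M B'"
    using outer_measure_of_attain[OF assms(2)] by blast
  have "outer_measure_of M (A \<union> B) \<le> outer_measure_of M (A' \<union> B')"
    by (rule outer_measure_of_mono) (use A' B' in auto)
  also have "\<dots> \<le> emeasure M A' + emeasure M B'"
    using A' B' by (simp add: emeasure_subadditive)
  finally show ?thesis using A' B' by simp
qed

lemma outer_measure_of_Collect_disj_le:
  assumes "\<And>\<omega>. \<omega> \<in> space M \<Longrightarrow> V \<omega> \<Longrightarrow> P \<omega> \<or> Q \<omega>"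
  shows "outer_measure_of M {\<omega> \<in> space M. V \<omega>}
    \<le> outer_measure_of M {\<omega> \<in> space M. P \<omega>} + outer_measure_of M {\<omega> \<in> space M. Q \<omega>}"
proof -
  have "outer_measure_of M {\<omega> \<in> space M. V \<omega>}
      \<le> outer_measure_of M ({\<omega> \<in> space M. P \<omega>} \<union> {\<omega> \<in> space M. Q \<omega>})"
    by (rule outer_measure_of_mono) (use assms in auto)
  also have "\<dots> \<le> outer_measure_of M {\<omega> \<in> space M. P \<omega>} + outer_measure_of M {\<omega> \<in> space M. Q \<omega>}"
    by (rule outer_measure_of_Un_le) auto
  finally show ?thesis .
qed

text \<open>The failure sets are united. This is why \<open>whp\<close> is phrased through failures:
  two nonmeasurable events of full outer measure may be disjoint, so full outer measure of the
  events themselves would not survive a conjunction.\<close>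

lemma whp_mono2:
  assumes "whp M P" "whp M Q"
    and imp: "\<And>n \<omega>. \<omega> \<in> space M \<Longrightarrow> P n \<omega> \<Longrightarrow> Q n \<omega> \<Longrightarrow> V n \<omega>"
  shows "whp M V"
  unfolding whp_def
proof (rule tendsto_sandwich[where f = "\<lambda>_. 0", OF always_eventually always_eventually])
  show "\<forall>n. outer_measure_of M {\<omega> \<in> space M. \<not> V n \<omega>}
      \<le> outer_measure_of M {\<omega> \<in> space M. \<not> P n \<omega>} + outer_measure_of M {\<omega> \<in> space M. \<not> Q n \<omega>}"
    by (intro allI outer_measure_of_Collect_disj_le) (use imp in blast)
  show "(\<lambda>n. outer_measure_of M {\<omega> \<in> space M. \<not> P n \<omega>}
      + outer_measure_of M {\<omega> \<in> space M. \<not> Q n \<omega>}) \<longlonglongrightarrow> 0"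
    using tendsto_add[OF assms(1,2)[unfolded whp_def]] by simp
qed simp_all

lemma whp_mono:
  assumes "whp M P" "\<And>n \<omega>. \<omega> \<in> space M \<Longrightarrow> P n \<omega> \<Longrightarrow> V n \<omega>"
  shows "whp M V"
proof (rule whp_mono2[OF assms(1) assms(1)])
  show "V n \<omega>" if "\<omega> \<in> space M" "P n \<omega>" for n \<omega>
    using that by (rule assms(2))
qed

lemma whp_conj: "whp M P \<Longrightarrow> whp M Q \<Longrightarrow> whp M (\<lambda>n \<omega>. P n \<omega> \<and> Q n \<omega>)"
  by (erule whp_mono2) auto

lemma whp_eventually:
  assumes "\<forall>\<^sub>F n in sequentially. \<forall>\<omega> \<in> space M. E n \<omega>"
  shows "whp M E"
  unfolding whp_def
proof (rule tendsto_eventually)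
  show "\<forall>\<^sub>F n in sequentially. outer_measure_of M {\<omega> \<in> space M. \<not> E n \<omega>} = 0"
    using assms
  proof eventually_elim
    case (elim n)
    then have "{\<omega> \<in> space M. \<not> E n \<omega>} = {}" by blast
    then show ?case by (simp only: outer_measure_of_eq sets.empty_sets emeasure_empty)
  qed
qed

text \<open>One measurable null set contains the failures for all n \<ge> k. The maximizer uses k =
  1, since it is specified for nonempty samples only.\<close>

lemma whp_AE:
  assumes "AE \<omega> in M. \<forall>n\<ge>k. E n \<omega>"
  shows "whp M E"
  unfolding whp_def
proof (rule tendsto_eventually, use eventually_ge_at_top[of k] in eventually_elim)
  fix n assume n: "k \<le> n"
  obtain N where N: "{\<omega> \<in> space M. \<not> (\<forall>n\<ge>k. E n \<omega>)} \<subseteq> N" "emeasure M N = 0" "N \<in> sets M"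
    using AE_E[OF assms] by blast
  have "outer_measure_of M {\<omega> \<in> space M. \<not> E n \<omega>} \<le> outer_measure_of M N"
    by (rule outer_measure_of_mono) (use N n in blast)
  then show "outer_measure_of M {\<omega> \<in> space M. \<not> E n \<omega>} = 0"
    using N by simp
qed

lemma o_P_iff_whp: "o_P M Z r \<longleftrightarrow> (\<forall>c>0. whp M (\<lambda>n \<omega>. Z n \<omega> \<le> ereal (c * r n)))"
  by (simp add: o_P_def whp_def not_le)

text \<open>The domination may fail on an event of vanishing outer probability; half of \<epsilon>
  pays for that event.\<close>

lemma O_P_mono:
  assumes Z: "O_P M Z r" and le: "whp M (\<lambda>n \<omega>. Y n \<omega> \<le> Z n \<omega>)"
  shows "O_P M Y r"
  unfolding O_P_def
proof (intro allI impI)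
  fix e :: real assume e: "e > 0"
  obtain C where C: "\<forall>\<^sub>F n in sequentially.
     outer_measure_of M {\<omega> \<in> space M. ereal (C * r n) < Z n \<omega>} \<le> ennreal (e/2)"
    using Z e unfolding O_P_def by (meson half_gt_zero)
  have "\<forall>\<^sub>F n in sequentially. outer_measure_of M {\<omega> \<in> space M. \<not> Y n \<omega> \<le> Z n \<omega>} < ennreal (e/2)"
    using le e unfolding whp_def by (intro order_tendstoD) auto
  with C have "\<forall>\<^sub>F n in sequentially.
     outer_measure_of M {\<omega> \<in> space M. ereal (C * r n) < Y n \<omega>} \<le> ennreal e"
  proof eventually_elim
    case (elim n)
    have "outer_measure_of M {\<omega> \<in> space M. ereal (C * r n) < Y n \<omega>}
      \<le> outer_measure_of M {\<omega> \<in> space M. ereal (C * r n) < Z n \<omega>}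
        + outer_measure_of M {\<omega> \<in> space M. \<not> Y n \<omega> \<le> Z n \<omega>}"
      by (rule outer_measure_of_Collect_disj_le) auto
    also have "\<dots> \<le> ennreal (e/2) + ennreal (e/2)"
      using elim by (intro add_mono) auto
    also have "\<dots> = ennreal e" using e by (simp flip: ennreal_plus)
    finally show ?case .
  qed
  then show "\<exists>C. \<forall>\<^sub>F n in sequentially.
     outer_measure_of M {\<omega> \<in> space M. ereal (C * r n) < Y n \<omega>} \<le> ennreal e" ..
qed

lemma O_P_rate_mono:
  assumes Z: "O_P M Z r" and le: "\<forall>\<^sub>F n in sequentially. 0 \<le> r n \<and> r n \<le> K * s n"
  shows "O_P M Z s"
  unfolding O_P_def
proof (intro allI impI)
  fix e :: real assume e: "e > 0"
  obtain C where C: "\<forall>\<^sub>F n in sequentially.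
     outer_measure_of M {\<omega> \<in> space M. ereal (C * r n) < Z n \<omega>} \<le> ennreal e"
    using Z e unfolding O_P_def by meson
  have "\<forall>\<^sub>F n in sequentially.
     outer_measure_of M {\<omega> \<in> space M. ereal ((\<bar>C\<bar> * K) * s n) < Z n \<omega>} \<le> ennreal e"
    using C le
  proof eventually_elim
    case (elim n)
    \<comment> \<open>The constant C may be negative, so its absolute value is taken before K is
      brought in.\<close>
    have "C * r n \<le> \<bar>C\<bar> * (K * s n)"
      using elim(2) by (intro mult_mono) auto
    then have "outer_measure_of M {\<omega> \<in> space M. ereal ((\<bar>C\<bar> * K) * s n) < Z n \<omega>}
       \<le> outer_measure_of M {\<omega> \<in> space M. ereal (C * r n) < Z n \<omega>}"
      by (intro outer_measure_of_mono) (auto simp: mult.assoc intro: le_less_trans[rotated])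
    with elim(1) show ?case by order
  qed
  then show "\<exists>C. \<forall>\<^sub>F n in sequentially.
     outer_measure_of M {\<omega> \<in> space M. ereal (C * s n) < Z n \<omega>} \<le> ennreal e" ..
qed

lemma O_P_powr_mono:
  assumes "O_P M Z (\<lambda>n. real n powr a)" "a \<le> b"
  shows "O_P M Z (\<lambda>n. real n powr b)"
  using assms(1)
proof (rule O_P_rate_mono[where K = 1])
  show "\<forall>\<^sub>F n in sequentially. 0 \<le> real n powr a \<and> real n powr a \<le> 1 * real n powr b"
    using eventually_ge_at_top[of 1] by eventually_elim (use assms(2) in \<open>auto intro: powr_mono\<close>)
qed

text \<open>Reduces the calculus of stochastic orders to a deterministic implication between bounds:
  for any constants of Y and Z a constant for W has to be produced. Sums, products and multiples are
  then one line each.\<close>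

lemma O_P_combine:
  assumes Y: "O_P M Y r" and Z: "O_P M Z s"
    and bd: "\<And>B C. \<exists>D. \<forall>\<^sub>F n in sequentially. \<forall>\<omega>\<in>space M.
      Y n \<omega> \<le> ereal (B * r n) \<longrightarrow> Z n \<omega> \<le> ereal (C * s n) \<longrightarrow> W n \<omega> \<le> ereal (D * q n)"
  shows "O_P M W q"
  unfolding O_P_def
proof (intro allI impI)
  fix e :: real assume e: "e > 0"
  obtain B where B: "\<forall>\<^sub>F n in sequentially.
     outer_measure_of M {\<omega> \<in> space M. ereal (B * r n) < Y n \<omega>} \<le> ennreal (e/2)"
    using Y e unfolding O_P_def by (meson half_gt_zero)
  obtain C where C: "\<forall>\<^sub>F n in sequentially.
     outer_measure_of M {\<omega> \<in> space M. ereal (C * s n) < Z n \<omega>} \<le> ennreal (e/2)"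
    using Z e unfolding O_P_def by (meson half_gt_zero)
  obtain D where D: "\<forall>\<^sub>F n in sequentially. \<forall>\<omega>\<in>space M.
      Y n \<omega> \<le> ereal (B * r n) \<longrightarrow> Z n \<omega> \<le> ereal (C * s n) \<longrightarrow> W n \<omega> \<le> ereal (D * q n)"
    using bd by blast
  from B C D have "\<forall>\<^sub>F n in sequentially.
     outer_measure_of M {\<omega> \<in> space M. ereal (D * q n) < W n \<omega>} \<le> ennreal e"
  proof eventually_elim
    case (elim n)
    have "outer_measure_of M {\<omega> \<in> space M. ereal (D * q n) < W n \<omega>}
      \<le> outer_measure_of M {\<omega> \<in> space M. ereal (B * r n) < Y n \<omega>}
        + outer_measure_of M {\<omega> \<in> space M. ereal (C * s n) < Z n \<omega>}"
      by (rule outer_measure_of_Collect_disj_le) (use elim(3) in \<open>meson not_le\<close>)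
    also have "\<dots> \<le> ennreal (e/2) + ennreal (e/2)"
      using elim by (intro add_mono) auto
    also have "\<dots> = ennreal e" using e by (simp flip: ennreal_plus)
    finally show ?case .
  qed
  then show "\<exists>C. \<forall>\<^sub>F n in sequentially.
     outer_measure_of M {\<omega> \<in> space M. ereal (C * q n) < W n \<omega>} \<le> ennreal e" ..
qed

lemma O_P_add:
  fixes Y Z :: "nat \<Rightarrow> 'w \<Rightarrow> real"
  assumes "O_P M Y r" "O_P M Z r"
  shows "O_P M (\<lambda>n \<omega>. Y n \<omega> + Z n \<omega>) r"
proof (rule O_P_combine[OF assms], goal_cases)
  case (1 B C)
  show ?case
    by (rule exI[of _ "B + C"]) (simp add: algebra_simps add_mono)
qed

lemma O_P_mult:
  fixes Y Z :: "nat \<Rightarrow> 'w \<Rightarrow> real"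
  assumes "O_P M Y r" "O_P M Z s" and "\<And>n \<omega>. 0 \<le> Y n \<omega>" "\<And>n \<omega>. 0 \<le> Z n \<omega>"
  shows "O_P M (\<lambda>n \<omega>. Y n \<omega> * Z n \<omega>) (\<lambda>n. r n * s n)"
proof (rule O_P_combine[OF assms(1,2)], goal_cases)
  case (1 B C)
  have "Y n \<omega> * Z n \<omega> \<le> (B * C) * (r n * s n)" if "Y n \<omega> \<le> B * r n" "Z n \<omega> \<le> C * s n" for n \<omega>
    using mult_mono'[OF that] assms(3,4) by (simp add: ac_simps)
  then show ?case
    by (intro exI[of _ "B * C"]) simp
qed

lemma O_P_cmult:
  fixes Z :: "nat \<Rightarrow> 'w \<Rightarrow> real"
  assumes "O_P M Z r" "0 \<le> K"
  shows "O_P M (\<lambda>n \<omega>. K * Z n \<omega>) r"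
proof (rule O_P_combine[OF assms(1,1)], goal_cases)
  case (1 B C)
  show ?case
    by (rule exI[of _ "K * B"]) (use assms(2) in \<open>simp add: mult.assoc mult_left_mono\<close>)
qed

lemma O_P_mult_powr:
  fixes Y Z :: "nat \<Rightarrow> 'w \<Rightarrow> real"
  assumes "O_P M Y (\<lambda>n. real n powr a)" "O_P M Z (\<lambda>n. real n powr b)"
    and "\<And>n \<omega>. 0 \<le> Y n \<omega>" "\<And>n \<omega>. 0 \<le> Z n \<omega>"
  shows "O_P M (\<lambda>n \<omega>. Y n \<omega> * Z n \<omega>) (\<lambda>n. real n powr (a + b))"
  using O_P_mult[OF assms] by (simp add: powr_add)

lemma O_P_of_rate:
  assumes "\<And>n. 0 \<le> r n"
  shows "O_P M (\<lambda>n \<omega>. ereal (r n)) r"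
  unfolding O_P_def by (intro allI impI exI[of _ 1]) simp

lemma O_P_imp_o_P:
  assumes Z: "O_P M Z r" and lim: "(\<lambda>n. r n / s n) \<longlonglongrightarrow> 0" and pos: "\<forall>\<^sub>F n in sequentially. 0 < s n"
  shows "o_P M Z s"
  unfolding o_P_def
proof (intro allI impI)
  fix c :: real assume c: "c > 0"
  show "(\<lambda>n. outer_measure_of M {\<omega> \<in> space M. ereal (c * s n) < Z n \<omega>}) \<longlonglongrightarrow> 0"
  proof (rule order_tendstoI)
    fix a :: ennreal assume "0 < a"
    \<comment> \<open>\<open>O_P\<close> quantifies over real \<epsilon>, while a is an extended
      number and possibly infinite; a real number strictly between 0 and a is chosen.\<close>
    then obtain e where e: "e > 0" "ennreal e < a"
      by (metis dense ennreal_cases ennreal_less_zero_iff less_top_ennreal order_less_trans top.not_eq_extremum)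
    then obtain C where C: "\<forall>\<^sub>F n in sequentially.
       outer_measure_of M {\<omega> \<in> space M. ereal (C * r n) < Z n \<omega>} \<le> ennreal e"
      using Z unfolding O_P_def by meson
    have "(\<lambda>n. C * (r n / s n)) \<longlonglongrightarrow> C * 0"
      by (intro tendsto_intros lim)
    \<comment> \<open>The constant C depends on \<epsilon> and is not controlled, but the vanishing
      ratio of the rates brings C r n below c s n.\<close>
    then have "\<forall>\<^sub>F n in sequentially. C * (r n / s n) < c"
      using c by (intro order_tendstoD) auto
    with C pos show "\<forall>\<^sub>F n in sequentially.
       outer_measure_of M {\<omega> \<in> space M. ereal (c * s n) < Z n \<omega>} < a"
    proof eventually_elim
      case (elim n)
      then have "C * r n \<le> c * s n" by (simp add: field_simps)
      then have "outer_measure_of M {\<omega> \<in> space M. ereal (c * s n) < Z n \<omega>}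
         \<le> outer_measure_of M {\<omega> \<in> space M. ereal (C * r n) < Z n \<omega>}"
        by (intro outer_measure_of_mono) (auto intro: le_less_trans[rotated])
      with elim(1) e show ?case by order
    qed
  qed simp
qed

lemma O_P_powr_imp_o_P:
  assumes Z: "O_P M Z (\<lambda>n. real n powr a)" and "a < b"
  shows "o_P M Z (\<lambda>n. real n powr b)"
  using Z
proof (rule O_P_imp_o_P)
  have "(\<lambda>n. real n powr (a - b)) \<longlonglongrightarrow> 0"
    using assms(2) filterlim_real_sequentially by (intro tendsto_neg_powr) auto
  then show "(\<lambda>n. real n powr a / real n powr b) \<longlonglongrightarrow> 0"
    by (simp add: powr_diff)
  show "\<forall>\<^sub>F n in sequentially. 0 < real n powr b"
    using eventually_gt_at_top[of 0] by eventually_elim auto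
qed

text \<open>\<open>o_P\<close> with rate 1, restricted to real values and with a strict bound, so
  that membership in open balls and the strict thresholds of perturbation arguments can be read off
  directly.\<close>

definition o_1 :: "'w measure \<Rightarrow> (nat \<Rightarrow> 'w \<Rightarrow> real) \<Rightarrow> bool" where
  "o_1 M Z \<longleftrightarrow> (\<forall>c>0. whp M (\<lambda>n \<omega>. Z n \<omega> < c))"

lemma o_1D: "o_1 M Z \<Longrightarrow> c > 0 \<Longrightarrow> whp M (\<lambda>n \<omega>. Z n \<omega> < c)"
  by (simp add: o_1_def)

lemma o_1_iff_o_P: "o_1 M Z \<longleftrightarrow> o_P M (\<lambda>n \<omega>. Z n \<omega>) (\<lambda>n. 1)"
proof
  assume "o_1 M Z"
  then show "o_P M (\<lambda>n \<omega>. Z n \<omega>) (\<lambda>n. 1)"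
    unfolding o_P_iff_whp o_1_def by (auto elim!: whp_mono intro: less_imp_le)
next
  assume Z: "o_P M (\<lambda>n \<omega>. Z n \<omega>) (\<lambda>n. 1)"
  have "whp M (\<lambda>n \<omega>. Z n \<omega> < c)" if "c > 0" for c
  proof -
    have "whp M (\<lambda>n \<omega>. ereal (Z n \<omega>) \<le> ereal (c/2 * 1))"
      using Z that unfolding o_P_iff_whp by (meson half_gt_zero)
    then show ?thesis by (rule whp_mono) (use that in auto)
  qed
  then show "o_1 M Z" by (simp add: o_1_def)
qed

lemma o_1_powr: "O_P M (\<lambda>n \<omega>. Z n \<omega>) (\<lambda>n. real n powr a) \<Longrightarrow> a < 0 \<Longrightarrow> o_1 M Z"
proof -
  assume "O_P M (\<lambda>n \<omega>. Z n \<omega>) (\<lambda>n. real n powr a)" "a < 0"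
  then have "o_P M (\<lambda>n \<omega>. Z n \<omega>) (\<lambda>n. real n powr 0)" by (rule O_P_powr_imp_o_P)
  then have "whp M (\<lambda>n \<omega>. ereal (Z n \<omega>) \<le> ereal (c * 1))" if "c > 0" for c
  proof -
    assume "o_P M (\<lambda>n \<omega>. Z n \<omega>) (\<lambda>n. real n powr 0)"
    then have 1: "whp M (\<lambda>n \<omega>. ereal (Z n \<omega>) \<le> ereal (c * real n powr 0))"
      using that by (simp only: o_P_iff_whp)
    \<comment> \<open>The index 0 is discarded because \<open>0 powr 0\<close> is 0, not 1.\<close>
    have 2: "whp M (\<lambda>n \<omega>. n > 0)"
      by (rule whp_eventually) (use eventually_gt_at_top[of 0] in eventually_elim, simp)
    from 1 2 show ?thesis by (rule whp_mono2) auto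
  qed
  then show ?thesis unfolding o_1_iff_o_P o_P_iff_whp by blast
qed

lemma o_1_add:
  assumes "o_1 M Y" "o_1 M Z"
  shows "o_1 M (\<lambda>n \<omega>. Y n \<omega> + Z n \<omega>)"
  unfolding o_1_def
proof (intro allI impI)
  fix c :: real assume "c > 0"
  then have "whp M (\<lambda>n \<omega>. Y n \<omega> < c/2)" "whp M (\<lambda>n \<omega>. Z n \<omega> < c/2)"
    using assms unfolding o_1_def by (meson half_gt_zero)+
  then show "whp M (\<lambda>n \<omega>. Y n \<omega> + Z n \<omega> < c)"
    by (rule whp_mono2) auto
qed

lemma o_1_mono:
  assumes "o_1 M Z" "whp M (\<lambda>n \<omega>. Y n \<omega> \<le> Z n \<omega>)"
  shows "o_1 M Y"
  unfolding o_1_def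
proof (intro allI impI)
  fix c :: real assume "c > 0"
  then have "whp M (\<lambda>n \<omega>. Z n \<omega> < c)" using assms(1) by (simp add: o_1_def)
  with assms(2) show "whp M (\<lambda>n \<omega>. Y n \<omega> < c)" by (rule whp_mono2) auto
qed

lemma o_1_mult:
  fixes Y Z :: "nat \<Rightarrow> 'w \<Rightarrow> real"
  assumes Y: "O_P M Y (\<lambda>n. 1)" and Z: "o_1 M Z" and nonneg: "\<And>n \<omega>. 0 \<le> Y n \<omega>" "\<And>n \<omega>. 0 \<le> Z n \<omega>"
  shows "o_1 M (\<lambda>n \<omega>. Y n \<omega> * Z n \<omega>)"
  unfolding o_1_def whp_def
proof (intro allI impI)
  fix c :: real assume c: "c > 0"
  show "(\<lambda>n. outer_measure_of M {\<omega> \<in> space M. \<not> Y n \<omega> * Z n \<omega> < c}) \<longlonglongrightarrow> 0"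
  proof (rule order_tendstoI)
    fix a :: ennreal assume "0 < a"
    then obtain e where e: "e > 0" "ennreal e < a"
      by (metis dense ennreal_cases ennreal_less_zero_iff less_top_ennreal order_less_trans top.not_eq_extremum)
    then obtain C where C: "\<forall>\<^sub>F n in sequentially.
       outer_measure_of M {\<omega> \<in> space M. ereal (C * 1) < Y n \<omega>} \<le> ennreal (e/2)"
      using Y unfolding O_P_def by (meson half_gt_zero)
    \<comment> \<open>Adding 1 keeps the denominator positive and makes |C| d strictly smaller than
      c.\<close>
    define d where "d = c / (\<bar>C\<bar> + 1)"
    have d: "d > 0" using c by (simp add: d_def)
    then have "\<forall>\<^sub>F n in sequentially. outer_measure_of M {\<omega> \<in> space M. \<not> Z n \<omega> < d} < ennreal (e/2)"
      using Z e unfolding o_1_def whp_def by (intro order_tendstoD) auto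
    with C show "\<forall>\<^sub>F n in sequentially. outer_measure_of M {\<omega> \<in> space M. \<not> Y n \<omega> * Z n \<omega> < c} < a"
    proof eventually_elim
      case (elim n)
      have "Y n \<omega> * Z n \<omega> < c" if "Y n \<omega> \<le> C" "Z n \<omega> < d" for \<omega>
      proof -
        have "Y n \<omega> * Z n \<omega> \<le> \<bar>C\<bar> * Z n \<omega>"
          using that nonneg by (intro mult_right_mono) auto
        also have "\<dots> \<le> \<bar>C\<bar> * d"
          using that by (intro mult_left_mono) auto
        also have "\<dots> < (\<bar>C\<bar> + 1) * d" using d by simp
        also have "\<dots> = c" by (simp add: d_def)
        finally show ?thesis .
      qed
      then have "outer_measure_of M {\<omega> \<in> space M. \<not> Y n \<omega> * Z n \<omega> < c}
        \<le> outer_measure_of M {\<omega> \<in> space M. ereal (C * 1) < Y n \<omega>}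
          + outer_measure_of M {\<omega> \<in> space M. \<not> Z n \<omega> < d}"
        by (intro outer_measure_of_Collect_disj_le) (force simp: not_less)
      also have "\<dots> \<le> ennreal (e/2) + ennreal (e/2)"
        using elim by (intro add_mono) auto
      also have "\<dots> = ennreal e" using e by (simp flip: ennreal_plus)
      finally show ?case using e by order
    qed
  qed simp
qed

text \<open>A stochastic bound makes an extended-valued supremum finite with high probability, since
  infinity exceeds every C r n. On the remaining event \<open>real_of_ereal\<close> returns 0, which
  is still below a nonnegative Z.\<close>

lemma O_P_real_of_ereal:
  assumes Z: "O_P M Z r" and nonneg: "\<And>n \<omega>. 0 \<le> Z n \<omega>" and r: "\<And>n. 0 \<le> r n"
  shows "O_P M (\<lambda>n \<omega>. real_of_ereal (Z n \<omega>)) r" "whp M (\<lambda>n \<omega>. Z n \<omega> = ereal (real_of_ereal (Z n \<omega>)))"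
proof -
  have "ereal (real_of_ereal (Z n \<omega>)) \<le> Z n \<omega>" for n \<omega>
    using nonneg[of n \<omega>] by (cases "Z n \<omega>") auto
  then show "O_P M (\<lambda>n \<omega>. real_of_ereal (Z n \<omega>)) r"
    using Z by (elim O_P_mono) (simp add: whp_eventually)
  show "whp M (\<lambda>n \<omega>. Z n \<omega> = ereal (real_of_ereal (Z n \<omega>)))"
    unfolding whp_def
  proof (rule order_tendstoI)
    fix a :: ennreal assume "0 < a"
    then obtain e where e: "e > 0" "ennreal e < a"
      by (metis dense ennreal_cases ennreal_less_zero_iff less_top_ennreal order_less_trans top.not_eq_extremum)
    then obtain C where "\<forall>\<^sub>F n in sequentially.
       outer_measure_of M {\<omega> \<in> space M. ereal (C * r n) < Z n \<omega>} \<le> ennreal e"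
      using Z unfolding O_P_def by meson
    then show "\<forall>\<^sub>F n in sequentially.
      outer_measure_of M {\<omega> \<in> space M. Z n \<omega> \<noteq> ereal (real_of_ereal (Z n \<omega>))} < a"
    proof eventually_elim
      case (elim n)
      have "outer_measure_of M {\<omega> \<in> space M. Z n \<omega> \<noteq> ereal (real_of_ereal (Z n \<omega>))}
        \<le> outer_measure_of M {\<omega> \<in> space M. ereal (C * r n) < Z n \<omega>}"
      proof (intro outer_measure_of_mono subsetI)
        fix \<omega> assume "\<omega> \<in> {\<omega> \<in> space M. Z n \<omega> \<noteq> ereal (real_of_ereal (Z n \<omega>))}"
        then show "\<omega> \<in> {\<omega> \<in> space M. ereal (C * r n) < Z n \<omega>}"
          using nonneg[of n \<omega>] by (cases "Z n \<omega>") auto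
      qed
      with elim e show ?case by order
    qed
  qed simp
qed

section \<open>Matrices, gradients and Hessians\<close>

text \<open>The norm of the matrix type is the Frobenius norm, so Cauchy-Schwarz in each row
  suffices.\<close>

lemma norm_matrix_vector_mult_le:
  fixes A :: "real ^ 'n ^ 'm"
  shows "norm (A *v x) \<le> norm A * norm x"
proof -
  have "norm (A *v x) = L2_set (\<lambda>i. \<bar>A $ i \<bullet> x\<bar>) UNIV"
    by (simp add: norm_vec_def matrix_vector_mul_component)
  also have "\<dots> \<le> L2_set (\<lambda>i. norm (A $ i) * norm x) UNIV"
    by (rule L2_set_mono) (auto simp: Cauchy_Schwarz_ineq2)
  also have "\<dots> = norm A * norm x"
    by (simp add: norm_vec_def[of A] L2_set_left_distrib)
  finally show ?thesis .
qed

lemma norm_matrix_le_component_sum: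
  fixes A :: "real ^ 'n ^ 'm"
  shows "norm A \<le> (\<Sum>i\<in>UNIV. \<Sum>j\<in>UNIV. \<bar>A $ i $ j\<bar>)"
proof -
  have "norm A \<le> (\<Sum>i\<in>UNIV. norm (A $ i))"
    unfolding norm_vec_def by (rule L2_set_le_sum) simp
  also have "\<dots> \<le> (\<Sum>i\<in>UNIV. \<Sum>j\<in>UNIV. \<bar>A $ i $ j\<bar>)"
    by (intro sum_mono norm_le_l1_cart)
  finally show ?thesis .
qed

lemma matrix_vector_inv_mult:
  fixes A :: "real ^ 'n ^ 'n"
  assumes "invertible A"
  shows "A *v (matrix_inv A *v x) = x" "matrix_inv A *v (A *v x) = x"
proof -
  have "A ** matrix_inv A = mat 1" "matrix_inv A ** A = mat 1"
    using someI_ex[OF assms[unfolded invertible_def]] unfolding matrix_inv_def by auto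
  then show "A *v (matrix_inv A *v x) = x" "matrix_inv A *v (A *v x) = x"
    by (simp_all add: matrix_vector_mul_assoc)
qed

text \<open>A expands every vector by a factor of at least 2 c, and a perturbation of norm below c
  takes away at most half of this. The resulting lower bound gives injectivity, hence invertibility,
  and then the bound on the inverse, all with the same c.\<close>

lemma invertible_perturbation:
  fixes A :: "real ^ 'n::finite ^ 'n"
  assumes "invertible A"
  obtains c where "c > 0"
    "\<And>B x. norm (B - A) < c \<Longrightarrow> c * norm x \<le> norm (B *v x)"
    "\<And>B. norm (B - A) < c \<Longrightarrow> invertible B"
    "\<And>B x. norm (B - A) < c \<Longrightarrow> c * norm (matrix_inv B *v x) \<le> norm x"
proof -
  \<comment> \<open>Adding 1 to the norm gives positivity of K without an argument.\<close>
  define K where "K = norm (matrix_inv A) + 1"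
  have K: "K > 0" by (simp add: K_def add_nonneg_pos)
  define c where "c = 1 / (2 * K)"
  have c: "c > 0" using K by (simp add: c_def)
  have lower: "c * norm x \<le> norm (B *v x)" if "norm (B - A) < c" for B and x :: "real ^ 'n"
  proof -
    have "norm x = norm (matrix_inv A *v (A *v x))"
      using assms by (simp add: matrix_vector_inv_mult)
    also have "\<dots> \<le> norm (matrix_inv A) * norm (A *v x)"
      by (rule norm_matrix_vector_mult_le)
    also have "\<dots> \<le> K * norm (A *v x)"
      by (intro mult_right_mono) (auto simp: K_def)
    finally have 1: "2 * c * norm x \<le> norm (A *v x)"
      using K by (simp add: c_def field_simps)
    have "A *v x = B *v x - (B - A) *v x"
      by (simp add: matrix_vector_mult_diff_rdistrib)
    then have "norm (A *v x) \<le> norm (B *v x) + norm ((B - A) *v x)"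
      by (simp add: norm_triangle_ineq4)
    also have "norm ((B - A) *v x) \<le> norm (B - A) * norm x"
      by (rule norm_matrix_vector_mult_le)
    also have "\<dots> \<le> c * norm x"
      using that by (intro mult_right_mono) auto
    finally show ?thesis using 1 by simp
  qed
  have inv: "invertible B" if "norm (B - A) < c" for B
  proof -
    have "x = 0" if "B *v x = 0" for x
      using lower[OF \<open>norm (B - A) < c\<close>, of x] that c by (simp add: mult_le_0_iff)
    then show ?thesis
      using invertible_left_inverse matrix_left_invertible_ker by blast
  qed
  have "c * norm (matrix_inv B *v x) \<le> norm x" if "norm (B - A) < c" for B and x :: "real ^ 'n"
    using lower[OF that, of "matrix_inv B *v x"] inv[OF that] by (simp add: matrix_vector_inv_mult)
  with c lower inv show thesis by (rule that)
qed

lemma grad_works: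
  assumes "f differentiable (at \<theta>)"
  shows "(f has_derivative (\<lambda>h. grad f \<theta> \<bullet> h)) (at \<theta>)"
proof -
  let ?D = "frechet_derivative f (at \<theta>)"
  have D: "(f has_derivative ?D) (at \<theta>)"
    using assms by (simp add: frechet_derivative_works)
  then have lin: "linear ?D" by (rule has_derivative_linear)
  have "?D h = grad f \<theta> \<bullet> h" for h
  proof -
    have "?D h = ?D (\<Sum>i\<in>UNIV. h $ i *\<^sub>R axis i 1)"
      by (simp add: basis_expansion scalar_mult_eq_scaleR[symmetric])
    also have "\<dots> = (\<Sum>i\<in>UNIV. h $ i * ?D (axis i 1))"
      by (simp add: linear_sum[OF lin] linear_cmul[OF lin])
    also have "\<dots> = grad f \<theta> \<bullet> h"
      by (simp add: grad_def inner_vec_def mult.commute)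
    finally show ?thesis .
  qed
  then have "?D = (\<lambda>h. grad f \<theta> \<bullet> h)" by blast
  with D show ?thesis by simp
qed

lemma grad_eqI:
  assumes "(f has_derivative (\<lambda>h. v \<bullet> h)) (at \<theta>)"
  shows "grad f \<theta> = v"
proof -
  have "frechet_derivative f (at \<theta>) = (\<lambda>h. v \<bullet> h)"
    using frechet_derivative_at[OF assms] by simp
  then show ?thesis by (simp add: grad_def vec_eq_iff inner_axis)
qed

lemma grad_sum:
  assumes "\<And>i. i \<in> I \<Longrightarrow> f i differentiable (at \<theta>)"
  shows "grad (\<lambda>\<theta>. \<Sum>i\<in>I. f i \<theta>) \<theta> = (\<Sum>i\<in>I. grad (f i) \<theta>)"
proof (rule grad_eqI)
  show "((\<lambda>\<theta>. \<Sum>i\<in>I. f i \<theta>) has_derivative (\<lambda>h. (\<Sum>i\<in>I. grad (f i) \<theta>) \<bullet> h)) (at \<theta>)"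
    unfolding inner_sum_left by (intro has_derivative_sum grad_works assms)
qed

lemma grad_local_max:
  assumes "open B" "\<theta> \<in> B" "f differentiable (at \<theta>)" "\<And>t. t \<in> B \<Longrightarrow> f t \<le> f \<theta>"
  shows "grad f \<theta> = 0"
proof -
  have "(\<lambda>h. grad f \<theta> \<bullet> h) = (\<lambda>h. 0)"
    using assms by (intro differential_zero_maxmin[OF assms(2,1) grad_works]) auto
  then show ?thesis by (metis inner_eq_zero_iff)
qed

lemma hess_works:
  assumes "grad f differentiable (at \<theta>)"
  shows "(grad f has_derivative (\<lambda>h. hess f \<theta> *v h)) (at \<theta>)"
  using assms by (simp add: hess_def jacobian_works)

lemma hess_eqI:
  assumes "(grad f has_derivative (\<lambda>h. A *v h)) (at \<theta>)"
  shows "hess f \<theta> = A"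
  unfolding hess_def jacobian_def by (simp flip: frechet_derivative_at[OF assms])

text \<open>The Hessian differentiates the gradient, so additivity of the gradient must be known
  throughout a neighbourhood of \<theta>, not only at \<theta>.\<close>

lemma hess_sum:
  assumes "open B" "\<theta> \<in> B" "\<And>i t. i \<in> I \<Longrightarrow> t \<in> B \<Longrightarrow> twice_differentiable (f i) t"
  shows "hess (\<lambda>\<theta>. \<Sum>i\<in>I. f i \<theta>) \<theta> = (\<Sum>i\<in>I. hess (f i) \<theta>)"
proof (rule hess_eqI)
  have "((\<lambda>t. \<Sum>i\<in>I. grad (f i) t) has_derivative (\<lambda>h. \<Sum>i\<in>I. hess (f i) \<theta> *v h)) (at \<theta>)"
    using assms by (intro has_derivative_sum hess_works) (auto simp: twice_differentiable_def)
  then have "(grad (\<lambda>\<theta>. \<Sum>i\<in>I. f i \<theta>) has_derivative (\<lambda>h. \<Sum>i\<in>I. hess (f i) \<theta> *v h)) (at \<theta>)"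
    by (rule has_derivative_transform_within_open[OF _ assms(1,2)])
       (use assms(3) in \<open>auto simp: twice_differentiable_def grad_sum\<close>)
  also have "(\<lambda>h. \<Sum>i\<in>I. hess (f i) \<theta> *v h) = (\<lambda>h. (\<Sum>i\<in>I. hess (f i) \<theta>) *v h)"
    by (simp add: fun_eq_iff matrix_vector_mult_def vec_eq_iff sum_distrib_right sum.swap[of _ I])
  finally show "(grad (\<lambda>\<theta>. \<Sum>i\<in>I. f i \<theta>) has_derivative (\<lambda>h. (\<Sum>i\<in>I. hess (f i) \<theta>) *v h)) (at \<theta>)" .
qed

text \<open>Collects the deterministic consequences of smoothness and of bounded third derivatives
  on one set. It serves as an event of high probability in which the constant \<Lambda> is itself
  random.\<close>

definition lipschitz_score ::
  "nat \<Rightarrow> (real ^ 'd \<Rightarrow> real) \<Rightarrow> (real ^ 'd) set \<Rightarrow> real \<Rightarrow> bool" where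
  "lipschitz_score n S B \<Lambda> \<longleftrightarrow>
     (\<forall>\<theta>\<in>B. (ell_hat n S has_derivative (\<lambda>h. (hess S \<theta> /\<^sub>R n) *v h)) (at \<theta>)) \<and>
     (\<forall>\<theta>\<in>B. \<forall>\<theta>'\<in>B. norm (hess S \<theta> /\<^sub>R n - hess S \<theta>' /\<^sub>R n) \<le> \<Lambda> * norm (\<theta> - \<theta>'))"

lemma lipschitz_score_third:
  assumes "convex B" and S: "\<And>\<theta>. \<theta> \<in> B \<Longrightarrow> thrice_differentiable S \<theta>"
    and \<Lambda>: "\<And>\<theta>. \<theta> \<in> B \<Longrightarrow> onorm (\<lambda>h. third S \<theta> h /\<^sub>R n) \<le> \<Lambda>"
  shows "lipschitz_score n S B \<Lambda>"
  unfolding lipschitz_score_def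
proof (intro conjI ballI)
  fix \<theta> assume "\<theta> \<in> B"
  then have "(grad S has_derivative (\<lambda>h. hess S \<theta> *v h)) (at \<theta>)"
    using S by (auto intro: hess_works simp: thrice_differentiable_def twice_differentiable_def)
  then have "((\<lambda>\<theta>. grad S \<theta> /\<^sub>R n) has_derivative (\<lambda>h. (hess S \<theta> *v h) /\<^sub>R n)) (at \<theta>)"
    by (rule has_derivative_scaleR_right)
  then show "(ell_hat n S has_derivative (\<lambda>h. (hess S \<theta> /\<^sub>R n) *v h)) (at \<theta>)"
    unfolding ell_hat_def[abs_def] by (simp add: scaleR_matrix_vector_assoc)
next
  fix \<theta> \<theta>' assume \<theta>: "\<theta> \<in> B" "\<theta>' \<in> B"
  show "norm (hess S \<theta> /\<^sub>R n - hess S \<theta>' /\<^sub>R n) \<le> \<Lambda> * norm (\<theta> - \<theta>')"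
  proof (rule differentiable_bound[OF assms(1) _ \<Lambda> \<theta>])
    fix t assume "t \<in> B"
    then have "(hess S has_derivative third S t) (at t)"
      using S by (simp add: thrice_differentiable_def third_def frechet_derivative_works)
    then show "((\<lambda>t. hess S t /\<^sub>R n) has_derivative (\<lambda>h. third S t h /\<^sub>R n)) (at t within B)"
      by (intro has_derivative_scaleR_right) (rule has_derivative_at_withinI)
  qed
qed

text \<open>Mean value inequality for the score minus its linear part. The point a at which the
  Hessian is taken is kept apart from the end points x and y: a Newton step has a = x, whereas a
  difference quotient has a between or beside the two evaluation points.\<close>

lemma lipschitz_score_linearization:
  assumes S: "lipschitz_score n S B \<Lambda>" and "0 \<le> \<Lambda>" and B: "convex B" "a \<in> B" "x \<in> B" "y \<in> B"
    and r: "norm (x - a) \<le> r" "norm (y - a) \<le> r"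
  shows "norm (ell_hat n S y - ell_hat n S x - (hess S a /\<^sub>R n) *v (y - x)) \<le> \<Lambda> * r * norm (y - x)"
proof -
  \<comment> \<open>Within distance r of a the Hessian changes by at most \<Lambda> r, and as an
    intersection of convex sets \<open>?C\<close> contains the segment from x to y.\<close>
  let ?C = "B \<inter> cball a r"
  have conv: "convex ?C" using B(1) by (intro convex_Int) auto
  have xy: "x \<in> ?C" "y \<in> ?C" and a: "a \<in> ?C"
    using B r norm_ge_zero[of "x - a"] by (auto simp: dist_norm norm_minus_commute simp del: norm_ge_zero)
  have "norm (ell_hat n S y - ell_hat n S x - (hess S a /\<^sub>R n) *v (y - x)) \<le> norm (y - x) * (\<Lambda> * r)"
  proof (rule differentiable_bound_linearization[where S = ?C and f' = "\<lambda>t h. (hess S t /\<^sub>R n) *v h"])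
    show "x + t *\<^sub>R (y - x) \<in> ?C" if "t \<in> {0..1}" for t
      using convexD_alt[OF conv xy, of t] that by (simp add: algebra_simps)
    show "(ell_hat n S has_derivative (*v) (hess S t /\<^sub>R n)) (at t within ?C)" if "t \<in> ?C" for t
      using S that unfolding lipschitz_score_def by (blast intro: has_derivative_at_withinI)
    show "onorm ((*v) (hess S t /\<^sub>R n) - (*v) (hess S a /\<^sub>R n)) \<le> \<Lambda> * r" if t: "t \<in> ?C" for t
    proof (rule onorm_le)
      fix h :: "real ^ 'a"
      have "norm (((*v) (hess S t /\<^sub>R n) - (*v) (hess S a /\<^sub>R n)) h)
          = norm ((hess S t /\<^sub>R n - hess S a /\<^sub>R n) *v h)"
        by (simp add: matrix_vector_mult_diff_rdistrib)
      also have "\<dots> \<le> norm (hess S t /\<^sub>R n - hess S a /\<^sub>R n) * norm h"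
        by (rule norm_matrix_vector_mult_le)
      also have "norm (hess S t /\<^sub>R n - hess S a /\<^sub>R n) \<le> \<Lambda> * norm (t - a)"
        using S t B unfolding lipschitz_score_def by blast
      also have "\<Lambda> * norm (t - a) \<le> \<Lambda> * r"
        using t \<open>0 \<le> \<Lambda>\<close> by (intro mult_left_mono) (auto simp: dist_norm norm_minus_commute)
      finally show "norm (((*v) (hess S t /\<^sub>R n) - (*v) (hess S a /\<^sub>R n)) h) \<le> \<Lambda> * r * norm h"
        by (simp add: mult_right_mono)
    qed
    show "a \<in> ?C" by (rule a)
  qed
  then show ?thesis by (simp add: ac_simps)
qed

text \<open>Taylor expansion of the score at the current point \<theta>, using that the score
  vanishes at \<theta>'. The matrix A stands for an approximation of the negative Hessian, so its
  defect is A plus the Hessian, and 1 / c bounds the inverse of A.\<close>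

lemma newton_step_error:
  assumes S: "lipschitz_score n S B \<Lambda>" "0 \<le> \<Lambda>" "convex B" "\<theta> \<in> B" "\<theta>' \<in> B"
    and crit: "grad S \<theta>' = 0" and c: "c > 0"
    and A: "invertible A" "\<And>x. c * norm (matrix_inv A *v x) \<le> norm x"
  shows "norm (\<theta> + matrix_inv A *v ell_hat n S \<theta> - \<theta>')
    \<le> (1 / c) * (\<Lambda> * (norm (\<theta> - \<theta>'))\<^sup>2 + norm (A + hess S \<theta> /\<^sub>R n) * norm (\<theta> - \<theta>'))"
proof -
  let ?H = "hess S \<theta> /\<^sub>R n" and ?l = "ell_hat n S"
  have l0: "?l \<theta>' = 0" using crit by (simp add: ell_hat_def)
  have "\<theta> + matrix_inv A *v ?l \<theta> - \<theta>' = matrix_inv A *v (A *v (\<theta> - \<theta>') + ?l \<theta>)"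
    using A(1) by (simp add: matrix_vector_right_distrib matrix_vector_inv_mult)
  \<comment> \<open>Adding and subtracting the Hessian separates the defect of A from the Taylor
    remainder.\<close>
  also have "A *v (\<theta> - \<theta>') + ?l \<theta>
      = (A + ?H) *v (\<theta> - \<theta>') - (?l \<theta>' - ?l \<theta> - ?H *v (\<theta>' - \<theta>))"
    by (simp add: l0 matrix_vector_mult_add_rdistrib matrix_vector_mult_diff_distrib)
  finally have "c * norm (\<theta> + matrix_inv A *v ?l \<theta> - \<theta>')
      \<le> norm ((A + ?H) *v (\<theta> - \<theta>') - (?l \<theta>' - ?l \<theta> - ?H *v (\<theta>' - \<theta>)))"
    using A(2) by simp
  also have "\<dots> \<le> norm ((A + ?H) *v (\<theta> - \<theta>')) + norm (?l \<theta>' - ?l \<theta> - ?H *v (\<theta>' - \<theta>))"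
    by (rule norm_triangle_ineq4)
  also have "\<dots> \<le> norm (A + ?H) * norm (\<theta> - \<theta>') + \<Lambda> * norm (\<theta>' - \<theta>) * norm (\<theta>' - \<theta>)"
    by (intro add_mono norm_matrix_vector_mult_le lipschitz_score_linearization[OF S(1-3)]) (use S in auto)
  finally show ?thesis
    using c by (simp add: field_simps power2_eq_square norm_minus_commute)
qed

text \<open>Column j of the difference quotient is the increment of the score along axis j, divided
  by a step of order n powr (-1/2). Linearizing at \<theta>, the remainder is at most \<Lambda> r
  times the step, and division by the step leaves \<Lambda> r in each of the CARD('d)^2
  entries.\<close>

lemma I_hat_diff_error:
  fixes \<theta> :: "real ^ 'd::finite"
  assumes S: "lipschitz_score n S B \<Lambda>" "0 \<le> \<Lambda>" "convex B" and n: "n > 0" and t: "t1 < t2"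
    and B: "cball \<theta> (max \<bar>t1\<bar> \<bar>t2\<bar> * real n powr (-1/2)) \<subseteq> B"
  shows "norm (I_hat_diff t1 t2 n S \<theta> + hess S \<theta> /\<^sub>R n)
    \<le> (real CARD('d))\<^sup>2 * max \<bar>t1\<bar> \<bar>t2\<bar> * (\<Lambda> * real n powr (-1/2))"
proof -
  let ?H = "hess S \<theta> /\<^sub>R n" and ?l = "ell_hat n S"
  define s where "s = real n powr (-1/2)"
  define r where "r = max \<bar>t1\<bar> \<bar>t2\<bar> * s"
  have s: "s > 0" "s * s * n = 1"
    using n by (simp_all add: s_def powr_minus powr_half_sqrt divide_simps flip: powr_add)
  \<comment> \<open>This explains the prefactor s of \<open>I_hat_diff\<close>: it is 1 / (n s),
    that is, division of the gradient by n and of the difference by the step s.\<close>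
  have n_inv: "inverse (real n) = s * s"
    using s(2) n by (simp add: field_simps)
  have r: "0 \<le> r" using s by (simp add: r_def)
  have Br: "cball \<theta> r \<subseteq> B" using B by (simp add: r_def s_def)
  have entry: "\<bar>(I_hat_diff t1 t2 n S \<theta> + ?H) $ i $ j\<bar> \<le> \<Lambda> * r" for i j
  proof -
    let ?x = "\<theta> + (s * t1) *\<^sub>R axis j 1" and ?y = "\<theta> + (s * t2) *\<^sub>R axis j 1"
    let ?D = "?l ?y - ?l ?x - ?H *v (?y - ?x)"
    have yx: "?y - ?x = (s * (t2 - t1)) *\<^sub>R axis j 1" by (simp add: algebra_simps)
    have nyx: "norm (?y - ?x) = s * (t2 - t1)"
      unfolding yx using s t by (simp add: abs_mult)
    have nx: "norm (?x - \<theta>) \<le> r" "norm (?y - \<theta>) \<le> r"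
      using s by (auto simp: abs_mult r_def intro!: mult_right_mono)
    then have "\<theta> \<in> B" "?x \<in> B" "?y \<in> B"
      using Br r by (auto simp: dist_norm subset_iff norm_minus_commute)
    then have "norm ?D \<le> \<Lambda> * r * norm (?y - ?x)"
      using lipschitz_score_linearization[OF S] nx by blast
    then have D: "\<bar>?D $ i\<bar> \<le> \<Lambda> * r * (s * (t2 - t1))"
      using component_le_norm_cart[of ?D i] nyx by simp
    have "(?H *v (?y - ?x)) $ i = s * (t2 - t1) * ?H $ i $ j"
      unfolding yx by (simp add: matrix_vector_mult_scaleR matrix_vector_mult_basis column_def)
    then have D_eq: "?D $ i = (grad S ?y $ i - grad S ?x $ i) / n - s * (t2 - t1) * ?H $ i $ j"
      unfolding vector_minus_component by (simp add: ell_hat_def divide_inverse mult.commute right_diff_distrib)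
    have I_eq: "I_hat_diff t1 t2 n S \<theta> $ i $ j
        = - ((grad S ?y $ i - grad S ?x $ i) / n) / (s * (t2 - t1))"
      using s(1) t unfolding I_hat_diff_def s_def[symmetric] divide_inverse[of _ "real n"] n_inv
      by (simp add: field_simps)
    have alg: "d = - w * (a + h)" if "d = q - w * h" "a = - q / w" "w \<noteq> 0" for d q w h a :: real
      using that by (simp add: field_simps)
    \<comment> \<open>The remainder is the error of the entry multiplied by minus the step length,
      which therefore cancels in the bound.\<close>
    have "?D $ i = - (s * (t2 - t1)) * ((I_hat_diff t1 t2 n S \<theta> + ?H) $ i $ j)"
      unfolding vector_add_component using s t by (intro alg[OF D_eq I_eq]) simp
    then have "(s * (t2 - t1)) * \<bar>(I_hat_diff t1 t2 n S \<theta> + ?H) $ i $ j\<bar> \<le> (s * (t2 - t1)) * (\<Lambda> * r)"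
      using D s t by (simp add: abs_mult mult.commute)
    then show ?thesis using s t by simp
  qed
  have "norm (I_hat_diff t1 t2 n S \<theta> + ?H)
      \<le> (\<Sum>i\<in>UNIV. \<Sum>j\<in>UNIV. \<bar>(I_hat_diff t1 t2 n S \<theta> + ?H) $ i $ j\<bar>)"
    by (rule norm_matrix_le_component_sum)
  also have "\<dots> \<le> (\<Sum>i\<in>(UNIV::'d set). \<Sum>j\<in>(UNIV::'d set). \<Lambda> * r)"
    by (intro sum_mono entry)
  also have "\<dots> = (real CARD('d))\<^sup>2 * max \<bar>t1\<bar> \<bar>t2\<bar> * (\<Lambda> * s)"
    by (simp add: r_def power2_eq_square)
  finally show ?thesis by (simp add: s_def)
qed

section \<open>Rates of the iteration\<close>

text \<open>Interface between the statistical model and the analysis of the score equation: whatever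
  the sample contributes is condensed into the order of the score and the limit of the Hessian at
  \<theta>0. \<open>\<Lambda>\<close> is the random Lipschitz constant of the scaled Hessian on one
  fixed ball.\<close>

locale profile_iteration =
  fixes M :: "'w measure" and S :: "nat \<Rightarrow> 'w \<Rightarrow> real ^ 'd::finite \<Rightarrow> real"
    and \<theta>0 :: "real ^ 'd" and \<theta>hat :: "nat \<Rightarrow> 'w \<Rightarrow> real ^ 'd"
    and I0 :: "real ^ 'd ^ 'd" and \<rho> :: real and \<Lambda> :: "nat \<Rightarrow> 'w \<Rightarrow> real"
  assumes \<rho>: "\<rho> > 0"
    and lipschitz: "whp M (\<lambda>n \<omega>. lipschitz_score n (S n \<omega>) (ball \<theta>0 \<rho>) (\<Lambda> n \<omega>))"
    and \<Lambda>: "O_P M (\<lambda>n \<omega>. \<Lambda> n \<omega>) (\<lambda>n. 1)" "\<And>n \<omega>. 0 \<le> \<Lambda> n \<omega>"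
    and hess0: "o_1 M (\<lambda>n \<omega>. norm (hess (S n \<omega>) \<theta>0 /\<^sub>R n + I0))"
    and I0: "invertible I0"
    and consistent: "o_1 M (\<lambda>n \<omega>. norm (\<theta>hat n \<omega> - \<theta>0))"
    and crit: "whp M (\<lambda>n \<omega>. grad (S n \<omega>) (\<theta>hat n \<omega>) = 0)"
    and score: "O_P M (\<lambda>n \<omega>. norm (ell_hat n (S n \<omega>) \<theta>0)) (\<lambda>n. real n powr (-1/2))"
begin

text \<open>Writes the rate 1 as a power, so that in products all exponents simply add up.\<close>

lemma \<Lambda>_powr: "O_P M (\<lambda>n \<omega>. \<Lambda> n \<omega>) (\<lambda>n. real n powr 0)"
proof (rule O_P_rate_mono[OF \<Lambda>(1), of 1])
  show "\<forall>\<^sub>F n in sequentially. (0::real) \<le> 1 \<and> 1 \<le> 1 * real n powr 0"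
    using eventually_gt_at_top[of 0] by eventually_elim auto
qed

text \<open>The score is linearized between \<theta>0 and the maximizer; as it vanishes at the
  maximizer, only the linear part at \<theta>0 is left against the remainder.\<close>

lemma score_linearization:
  "whp M (\<lambda>n \<omega>. norm (ell_hat n (S n \<omega>) \<theta>0 + (hess (S n \<omega>) \<theta>0 /\<^sub>R n) *v (\<theta>hat n \<omega> - \<theta>0))
     \<le> \<Lambda> n \<omega> * (norm (\<theta>hat n \<omega> - \<theta>0))\<^sup>2)"
proof -
  have "whp M (\<lambda>n \<omega>. norm (\<theta>hat n \<omega> - \<theta>0) < \<rho>)"
    using consistent \<rho> by (rule o_1D)
  from whp_conj[OF this crit] lipschitz show ?thesis
  proof (rule whp_mono2)
    fix n \<omega>
    let ?H = "hess (S n \<omega>) \<theta>0 /\<^sub>R n" and ?l = "ell_hat n (S n \<omega>)"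
    assume *: "norm (\<theta>hat n \<omega> - \<theta>0) < \<rho> \<and> grad (S n \<omega>) (\<theta>hat n \<omega>) = 0"
      and lip: "lipschitz_score n (S n \<omega>) (ball \<theta>0 \<rho>) (\<Lambda> n \<omega>)"
    have in_ball: "\<theta>hat n \<omega> \<in> ball \<theta>0 \<rho>" "\<theta>0 \<in> ball \<theta>0 \<rho>"
      using * \<rho> by (simp_all add: dist_norm norm_minus_commute)
    have "norm (?l (\<theta>hat n \<omega>) - ?l \<theta>0 - ?H *v (\<theta>hat n \<omega> - \<theta>0))
        \<le> \<Lambda> n \<omega> * norm (\<theta>hat n \<omega> - \<theta>0) * norm (\<theta>hat n \<omega> - \<theta>0)"
      by (rule lipschitz_score_linearization[OF lip \<Lambda>(2)]) (use in_ball in auto)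
    moreover have "?l (\<theta>hat n \<omega>) = 0" using * by (simp add: ell_hat_def)
    ultimately show "norm (?l \<theta>0 + ?H *v (\<theta>hat n \<omega> - \<theta>0)) \<le> \<Lambda> n \<omega> * (norm (\<theta>hat n \<omega> - \<theta>0))\<^sup>2"
      using norm_minus_cancel[of "?l \<theta>0 + ?H *v (\<theta>hat n \<omega> - \<theta>0)"]
      by (simp add: power2_eq_square algebra_simps)
  qed
qed

lemma root_n_consistent:
  "O_P M (\<lambda>n \<omega>. norm (\<theta>hat n \<omega> - \<theta>0)) (\<lambda>n. real n powr (-1/2))"
proof -
  obtain c where c: "c > 0"
      "\<And>B x. norm (B - I0) < c \<Longrightarrow> c * norm x \<le> norm (B *v x)"
    by (rule invertible_perturbation[OF I0]) blast
  \<comment> \<open>The Hessian is close to - \<open>I0\<close>, while the perturbation bound is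
    stated near \<open>I0\<close>; changing the sign alters no norm.\<close>
  have c': "c * norm x \<le> norm (B *v x)" if "norm (B + I0) < c" for B and x :: "real ^ 'd"
  proof -
    have "c * norm x \<le> norm ((- B) *v x)"
      using that norm_minus_cancel[of "B + I0"] by (intro c(2)) simp
    also have "(- B) *v x = - (B *v x)"
      by (simp add: matrix_vector_mult_def vec_eq_iff sum_negf)
    finally show ?thesis by simp
  qed
  have "whp M (\<lambda>n \<omega>. norm (hess (S n \<omega>) \<theta>0 /\<^sub>R n + I0) < c)"
    using hess0 c(1) by (rule o_1D)
  \<comment> \<open>By consistency the quadratic remainder is at most half of the lower bound c
    |\<theta>hat - \<theta>0| of the linear term, so it can be moved to the left-hand side.\<close>
  moreover have "whp M (\<lambda>n \<omega>. \<Lambda> n \<omega> * norm (\<theta>hat n \<omega> - \<theta>0) < c / 2)"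
    using c(1) by (intro o_1D[OF o_1_mult[OF \<Lambda>(1) consistent \<Lambda>(2)]]) auto
  ultimately have "whp M (\<lambda>n \<omega>. norm (hess (S n \<omega>) \<theta>0 /\<^sub>R n + I0) < c
      \<and> \<Lambda> n \<omega> * norm (\<theta>hat n \<omega> - \<theta>0) < c / 2)"
    by (rule whp_conj)
  from this score_linearization
  have "whp M (\<lambda>n \<omega>. norm (\<theta>hat n \<omega> - \<theta>0) \<le> (2 / c) * norm (ell_hat n (S n \<omega>) \<theta>0))"
  proof (rule whp_mono2)
    fix n \<omega>
    let ?H = "hess (S n \<omega>) \<theta>0 /\<^sub>R n" and ?l = "ell_hat n (S n \<omega>)" and ?d = "\<theta>hat n \<omega> - \<theta>0"
    assume *: "norm (?H + I0) < c \<and> \<Lambda> n \<omega> * norm ?d < c / 2"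
      and lin: "norm (?l \<theta>0 + ?H *v ?d) \<le> \<Lambda> n \<omega> * (norm ?d)\<^sup>2"
    have "c * norm ?d \<le> norm (?H *v ?d)" using * by (intro c') simp
    also have "\<dots> \<le> norm (?l \<theta>0 + ?H *v ?d) + norm (?l \<theta>0)"
      by (metis add_diff_cancel_left' norm_triangle_ineq4)
    also have "norm (?l \<theta>0 + ?H *v ?d) \<le> (\<Lambda> n \<omega> * norm ?d) * norm ?d"
      using lin by (simp add: power2_eq_square mult.assoc)
    also have "\<dots> \<le> c / 2 * norm ?d"
      using * by (intro mult_right_mono) auto
    finally show "norm ?d \<le> (2 / c) * norm (?l \<theta>0)"
      using c(1) by (simp add: field_simps)
  qed
  then show ?thesis
    using c(1) by (intro O_P_mono[OF O_P_cmult[OF score, of "2 / c"]]) auto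
qed

text \<open>Lipschitz continuity carries the limit of the Hessian from \<theta>0 to every consistent
  sequence: a factor bounded in probability times o_P(1) is o_P(1).\<close>

lemma hess_near:
  assumes "o_1 M (\<lambda>n \<omega>. norm (\<theta> n \<omega> - \<theta>0))"
  shows "o_1 M (\<lambda>n \<omega>. norm (hess (S n \<omega>) (\<theta> n \<omega>) /\<^sub>R n + I0))"
proof -
  have "o_1 M (\<lambda>n \<omega>. norm (hess (S n \<omega>) \<theta>0 /\<^sub>R n + I0) + \<Lambda> n \<omega> * norm (\<theta> n \<omega> - \<theta>0))"
    by (intro o_1_add hess0 o_1_mult \<Lambda> assms norm_ge_zero)
  moreover have "whp M (\<lambda>n \<omega>. norm (hess (S n \<omega>) (\<theta> n \<omega>) /\<^sub>R n + I0)
      \<le> norm (hess (S n \<omega>) \<theta>0 /\<^sub>R n + I0) + \<Lambda> n \<omega> * norm (\<theta> n \<omega> - \<theta>0))"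
  proof -
    have "whp M (\<lambda>n \<omega>. norm (\<theta> n \<omega> - \<theta>0) < \<rho>)"
      using assms \<rho> by (rule o_1D)
    from this lipschitz show ?thesis
    proof (rule whp_mono2)
      fix n \<omega>
      let ?H = "\<lambda>\<theta>. hess (S n \<omega>) \<theta> /\<^sub>R n"
      assume *: "norm (\<theta> n \<omega> - \<theta>0) < \<rho>"
        and lip: "lipschitz_score n (S n \<omega>) (ball \<theta>0 \<rho>) (\<Lambda> n \<omega>)"
      have "\<theta> n \<omega> \<in> ball \<theta>0 \<rho>" "\<theta>0 \<in> ball \<theta>0 \<rho>"
        using * \<rho> by (simp_all add: dist_norm norm_minus_commute)
      then have "norm (?H (\<theta> n \<omega>) - ?H \<theta>0) \<le> \<Lambda> n \<omega> * norm (\<theta> n \<omega> - \<theta>0)"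
        using lip unfolding lipschitz_score_def by blast
      moreover have "norm (?H (\<theta> n \<omega>) + I0) \<le> norm (?H (\<theta> n \<omega>) - ?H \<theta>0) + norm (?H \<theta>0 + I0)"
        using norm_triangle_ineq[of "?H (\<theta> n \<omega>) - ?H \<theta>0" "?H \<theta>0 + I0"] by simp
      ultimately show "norm (?H (\<theta> n \<omega>) + I0) \<le> norm (?H \<theta>0 + I0) + \<Lambda> n \<omega> * norm (\<theta> n \<omega> - \<theta>0)"
        by simp
    qed
  qed
  ultimately show ?thesis by (rule o_1_mono)
qed

lemma o_1_of_rate:
  assumes "O_P M (\<lambda>n \<omega>. norm (\<theta> n \<omega> - \<theta>hat n \<omega>)) (\<lambda>n. real n powr (- r))" "r > 0"
  shows "o_1 M (\<lambda>n \<omega>. norm (\<theta> n \<omega> - \<theta>0))"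
proof -
  have "o_1 M (\<lambda>n \<omega>. norm (\<theta> n \<omega> - \<theta>hat n \<omega>) + norm (\<theta>hat n \<omega> - \<theta>0))"
    by (rule o_1_add[OF o_1_powr[OF assms(1)] consistent]) (use assms(2) in simp)
  then show ?thesis
  proof (rule o_1_mono, intro whp_eventually always_eventually allI ballI)
    fix n \<omega>
    show "norm (\<theta> n \<omega> - \<theta>0) \<le> norm (\<theta> n \<omega> - \<theta>hat n \<omega>) + norm (\<theta>hat n \<omega> - \<theta>0)"
      using norm_triangle_ineq[of "\<theta> n \<omega> - \<theta>hat n \<omega>" "\<theta>hat n \<omega> - \<theta>0"] by simp
  qed
qed

text \<open>The two bounds on s are the orders of the two error terms of a Newton step: 2 r for the
  quadratic remainder and r + q for the defect of A. Positivity of q makes A consistent for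
  \<open>I0\<close>, hence invertible with high probability.\<close>

lemma step_rate:
  fixes \<theta> :: "nat \<Rightarrow> 'w \<Rightarrow> real ^ 'd" and A :: "nat \<Rightarrow> 'w \<Rightarrow> real ^ 'd ^ 'd"
  assumes \<theta>: "O_P M (\<lambda>n \<omega>. norm (\<theta> n \<omega> - \<theta>hat n \<omega>)) (\<lambda>n. real n powr (- r))" "r > 0"
    and A: "O_P M (\<lambda>n \<omega>. norm (A n \<omega> + hess (S n \<omega>) (\<theta> n \<omega>) /\<^sub>R n)) (\<lambda>n. real n powr (- q))" "q > 0"
    and s: "s \<le> 2 * r" "s \<le> r + q"
  shows "O_P M (\<lambda>n \<omega>. norm (\<theta> n \<omega> + matrix_inv (A n \<omega>) *v ell_hat n (S n \<omega>) (\<theta> n \<omega>) - \<theta>hat n \<omega>))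
    (\<lambda>n. real n powr (- s))"
proof -
  let ?H = "\<lambda>n \<omega>. hess (S n \<omega>) (\<theta> n \<omega>) /\<^sub>R n" and ?d = "\<lambda>n \<omega>. norm (\<theta> n \<omega> - \<theta>hat n \<omega>)"
  obtain c where c: "c > 0"
      "\<And>B. norm (B - I0) < c \<Longrightarrow> invertible B"
      "\<And>B x. norm (B - I0) < c \<Longrightarrow> c * norm (matrix_inv B *v x) \<le> norm x"
    by (rule invertible_perturbation[OF I0]) blast
  have near: "o_1 M (\<lambda>n \<omega>. norm (\<theta> n \<omega> - \<theta>0))" by (rule o_1_of_rate[OF \<theta>])
  have "o_1 M (\<lambda>n \<omega>. norm (A n \<omega> + ?H n \<omega>) + norm (?H n \<omega> + I0))"
  proof (rule o_1_add)
    show "o_1 M (\<lambda>n \<omega>. norm (A n \<omega> + ?H n \<omega>))"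
      using A(1) by (rule o_1_powr) (use A(2) in linarith)
    show "o_1 M (\<lambda>n \<omega>. norm (?H n \<omega> + I0))"
      by (rule hess_near[OF near])
  qed
  then have "whp M (\<lambda>n \<omega>. norm (A n \<omega> + ?H n \<omega>) + norm (?H n \<omega> + I0) < c)"
    using c(1) by (rule o_1D)
  then have A_near: "whp M (\<lambda>n \<omega>. norm (A n \<omega> - I0) < c)"
  proof (rule whp_mono)
    fix n \<omega> assume "norm (A n \<omega> + ?H n \<omega>) + norm (?H n \<omega> + I0) < c"
    \<comment> \<open>The Hessian cancels: the defect of A minus the deviation of the Hessian from -
      \<open>I0\<close> is A - I0.\<close>
    moreover have "norm (A n \<omega> - I0) \<le> norm (A n \<omega> + ?H n \<omega>) + norm (?H n \<omega> + I0)"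
      using norm_triangle_ineq4[of "A n \<omega> + ?H n \<omega>" "?H n \<omega> + I0"] by simp
    ultimately show "norm (A n \<omega> - I0) < c" by simp
  qed
  have "whp M (\<lambda>n \<omega>. norm (\<theta> n \<omega> - \<theta>0) < \<rho>)" "whp M (\<lambda>n \<omega>. norm (\<theta>hat n \<omega> - \<theta>0) < \<rho>)"
    using near consistent \<rho> by (auto intro: o_1D)
  then have in_ball: "whp M (\<lambda>n \<omega>. \<theta> n \<omega> \<in> ball \<theta>0 \<rho> \<and> \<theta>hat n \<omega> \<in> ball \<theta>0 \<rho>)"
    by (rule whp_mono2) (simp add: dist_norm norm_minus_commute)
  have bound: "whp M (\<lambda>n \<omega>. norm (\<theta> n \<omega> + matrix_inv (A n \<omega>) *v ell_hat n (S n \<omega>) (\<theta> n \<omega>) - \<theta>hat n \<omega>)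
      \<le> (1 / c) * (\<Lambda> n \<omega> * (?d n \<omega> * ?d n \<omega>) + norm (A n \<omega> + ?H n \<omega>) * ?d n \<omega>))"
    using whp_conj[OF A_near crit] whp_conj[OF in_ball lipschitz]
  proof (rule whp_mono2)
    fix n \<omega>
    assume *: "norm (A n \<omega> - I0) < c \<and> grad (S n \<omega>) (\<theta>hat n \<omega>) = 0"
      "(\<theta> n \<omega> \<in> ball \<theta>0 \<rho> \<and> \<theta>hat n \<omega> \<in> ball \<theta>0 \<rho>) \<and> lipschitz_score n (S n \<omega>) (ball \<theta>0 \<rho>) (\<Lambda> n \<omega>)"
    show "norm (\<theta> n \<omega> + matrix_inv (A n \<omega>) *v ell_hat n (S n \<omega>) (\<theta> n \<omega>) - \<theta>hat n \<omega>)
      \<le> (1 / c) * (\<Lambda> n \<omega> * (?d n \<omega> * ?d n \<omega>) + norm (A n \<omega> + ?H n \<omega>) * ?d n \<omega>)"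
      using * c unfolding power2_eq_square[symmetric]
      by (intro newton_step_error[of _ _ "ball \<theta>0 \<rho>"] \<Lambda>(2)) auto
  qed
  have "O_P M (\<lambda>n \<omega>. \<Lambda> n \<omega> * (?d n \<omega> * ?d n \<omega>)) (\<lambda>n. real n powr (- s))"
    by (rule O_P_powr_mono[OF O_P_mult_powr[OF \<Lambda>_powr O_P_mult_powr[OF \<theta>(1) \<theta>(1)]]])
      (use \<Lambda>(2) s(1) in simp_all)
  moreover have "O_P M (\<lambda>n \<omega>. norm (A n \<omega> + ?H n \<omega>) * ?d n \<omega>) (\<lambda>n. real n powr (- s))"
    by (rule O_P_powr_mono[OF O_P_mult_powr[OF A(1) \<theta>(1)]]) (use s(2) in simp_all)
  ultimately have "O_P M (\<lambda>n \<omega>. (1 / c) * (\<Lambda> n \<omega> * (?d n \<omega> * ?d n \<omega>) + norm (A n \<omega> + ?H n \<omega>) * ?d n \<omega>))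
      (\<lambda>n. real n powr (- s))"
    by (intro O_P_cmult O_P_add) (use c(1) in simp_all)
  then show ?thesis by (rule O_P_mono) (use bound in simp)
qed

text \<open>Iterates are compared with the maximizer, the initial estimator with \<theta>0. Because
  \<psi> \<le> 1/2, the root-n error of the maximizer does not spoil the rate.\<close>

lemma init_rate:
  assumes "O_P M (\<lambda>n \<omega>. norm (\<theta> n \<omega> - \<theta>0)) (\<lambda>n. real n powr (- \<psi>))" "\<psi> \<le> 1/2"
  shows "O_P M (\<lambda>n \<omega>. norm (\<theta> n \<omega> - \<theta>hat n \<omega>)) (\<lambda>n. real n powr (- \<psi>))"
proof -
  have "O_P M (\<lambda>n \<omega>. norm (\<theta>hat n \<omega> - \<theta>0)) (\<lambda>n. real n powr (- \<psi>))"
    using root_n_consistent by (rule O_P_powr_mono) (use assms(2) in simp)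
  with assms(1) have "O_P M (\<lambda>n \<omega>. norm (\<theta> n \<omega> - \<theta>0) + norm (\<theta>hat n \<omega> - \<theta>0)) (\<lambda>n. real n powr (- \<psi>))"
    by (rule O_P_add)
  then show ?thesis
  proof (rule O_P_mono, intro whp_eventually always_eventually allI ballI)
    fix n \<omega>
    show "ereal (norm (\<theta> n \<omega> - \<theta>hat n \<omega>)) \<le> ereal (norm (\<theta> n \<omega> - \<theta>0) + norm (\<theta>hat n \<omega> - \<theta>0))"
      using norm_triangle_ineq4[of "\<theta> n \<omega> - \<theta>0" "\<theta>hat n \<omega> - \<theta>0"] by simp
  qed
qed

text \<open>The exponent q of the defect may depend on k, so that one induction covers both
  constructions: the defect is zero in (I) and has a fixed rate in (II). The induction hypothesis
  also yields the consistency of the current iterate that the premise on \<open>Ihat\<close> asks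
  for.\<close>

lemma iterate_rate:
  assumes init: "O_P M (\<lambda>n \<omega>. norm (\<theta>init n \<omega> - \<theta>0)) (\<lambda>n. real n powr (- \<psi>))" "\<psi> \<le> 1/2"
    and Ihat: "\<And>k \<theta>. o_1 M (\<lambda>n \<omega>. norm (\<theta> n \<omega> - \<theta>0)) \<Longrightarrow>
      O_P M (\<lambda>n \<omega>. norm (Ihat n (S n \<omega>) (\<theta> n \<omega>) + hess (S n \<omega>) (\<theta> n \<omega>) /\<^sub>R n))
        (\<lambda>n. real n powr (- q k))"
    and r: "r 0 = \<psi>" "\<And>k. r k > 0" "\<And>k. q k > 0" "\<And>k. r (Suc k) \<le> 2 * r k"
      "\<And>k. r (Suc k) \<le> r k + q k"
  shows "O_P M (\<lambda>n \<omega>. norm (iterate Ihat n (S n \<omega>) (\<theta>init n \<omega>) k - \<theta>hat n \<omega>))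
    (\<lambda>n. real n powr (- r k))"
proof (induction k)
  case 0
  show ?case using init_rate[OF init] by (simp add: iterate_def r)
next
  case (Suc k)
  have "o_1 M (\<lambda>n \<omega>. norm (iterate Ihat n (S n \<omega>) (\<theta>init n \<omega>) k - \<theta>0))"
    using Suc r(2) by (rule o_1_of_rate)
  from step_rate[OF Suc r(2) Ihat[OF this] r(3) r(4) r(5)] show ?case
    by (simp add: iterate_def)
qed

text \<open>The matrix inside the norm is identically zero, hence the free exponent.\<close>

lemma I_hat_hess_rate:
  "O_P M (\<lambda>n \<omega>. norm (I_hat_hess n (S n \<omega>) (\<theta> n \<omega>) + hess (S n \<omega>) (\<theta> n \<omega>) /\<^sub>R n))
    (\<lambda>n. real n powr a)"
  unfolding I_hat_hess_def
  by (rule O_P_mono[OF O_P_of_rate[where r = "\<lambda>n. real n powr a"]])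
     (auto intro!: whp_eventually always_eventually)

lemma I_hat_diff_rate:
  assumes near: "o_1 M (\<lambda>n \<omega>. norm (\<theta> n \<omega> - \<theta>0))" and t: "t1 < t2"
  shows "O_P M (\<lambda>n \<omega>. norm (I_hat_diff t1 t2 n (S n \<omega>) (\<theta> n \<omega>) + hess (S n \<omega>) (\<theta> n \<omega>) /\<^sub>R n))
    (\<lambda>n. real n powr (- (1/2)))"
proof -
  define K where "K = (real CARD('d))\<^sup>2 * max \<bar>t1\<bar> \<bar>t2\<bar>"
  \<comment> \<open>Half of the radius is reserved for the displacement of the evaluation points and
    half for the distance of \<theta> from \<theta>0.\<close>
  have "((\<lambda>n. max \<bar>t1\<bar> \<bar>t2\<bar> * real n powr (-1/2)) \<longlongrightarrow> max \<bar>t1\<bar> \<bar>t2\<bar> * 0) sequentially"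
    by (intro tendsto_intros tendsto_neg_powr filterlim_real_sequentially) simp
  then have "\<forall>\<^sub>F n in sequentially. max \<bar>t1\<bar> \<bar>t2\<bar> * real n powr (-1/2) < \<rho> / 2"
    using \<rho> by (intro order_tendstoD) auto
  then have "whp M (\<lambda>n \<omega>. max \<bar>t1\<bar> \<bar>t2\<bar> * real n powr (-1/2) < \<rho> / 2 \<and> n > 0)"
    using eventually_gt_at_top[of 0] by (intro whp_eventually; eventually_elim) simp
  moreover have "whp M (\<lambda>n \<omega>. norm (\<theta> n \<omega> - \<theta>0) < \<rho> / 2)"
    using near by (rule o_1D) (use \<rho> in simp)
  ultimately have "whp M (\<lambda>n \<omega>. n > 0 \<and> cball (\<theta> n \<omega>) (max \<bar>t1\<bar> \<bar>t2\<bar> * real n powr (-1/2)) \<subseteq> ball \<theta>0 \<rho>)"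
    by (rule whp_mono2) (auto simp: cball_subset_ball_iff dist_norm)
  from this lipschitz
  have bound: "whp M (\<lambda>n \<omega>. norm (I_hat_diff t1 t2 n (S n \<omega>) (\<theta> n \<omega>) + hess (S n \<omega>) (\<theta> n \<omega>) /\<^sub>R n)
      \<le> K * (\<Lambda> n \<omega> * real n powr (-1/2)))"
  proof (rule whp_mono2)
    fix n \<omega>
    assume "n > 0 \<and> cball (\<theta> n \<omega>) (max \<bar>t1\<bar> \<bar>t2\<bar> * real n powr (-1/2)) \<subseteq> ball \<theta>0 \<rho>"
      "lipschitz_score n (S n \<omega>) (ball \<theta>0 \<rho>) (\<Lambda> n \<omega>)"
    then show "norm (I_hat_diff t1 t2 n (S n \<omega>) (\<theta> n \<omega>) + hess (S n \<omega>) (\<theta> n \<omega>) /\<^sub>R n)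
        \<le> K * (\<Lambda> n \<omega> * real n powr (-1/2))"
      unfolding K_def using \<Lambda>(2) t by (intro I_hat_diff_error) auto
  qed
  have "O_P M (\<lambda>n \<omega>. \<Lambda> n \<omega> * real n powr (-1/2)) (\<lambda>n. real n powr (0 + -1/2))"
    using O_P_mult_powr[OF \<Lambda>_powr O_P_of_rate[where r = "\<lambda>n. real n powr (-1/2)"]] \<Lambda>(2) by simp
  then have "O_P M (\<lambda>n \<omega>. K * (\<Lambda> n \<omega> * real n powr (-1/2))) (\<lambda>n. real n powr (0 + -1/2))"
    by (rule O_P_cmult) (simp add: K_def)
  \<comment> \<open>The exponent is put into the form - q, with q = 1/2, which
    \<open>iterate_rate\<close> expects.\<close>
  then have "O_P M (\<lambda>n \<omega>. K * (\<Lambda> n \<omega> * real n powr (-1/2))) (\<lambda>n. real n powr (- (1/2)))"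
    by simp
  then show ?thesis by (rule O_P_mono) (use bound in simp)
qed

end

section \<open>Independent identically distributed samples\<close>

lemma O_P_sum:
  fixes Z :: "'i \<Rightarrow> nat \<Rightarrow> 'w \<Rightarrow> real"
  assumes "finite I" "\<And>n. 0 \<le> r n" "\<And>i. i \<in> I \<Longrightarrow> O_P M (\<lambda>n \<omega>. Z i n \<omega>) r"
  shows "O_P M (\<lambda>n \<omega>. \<Sum>i\<in>I. Z i n \<omega>) r"
  using assms(1,3)
proof (induction I rule: finite_induct)
  case empty
  have "O_P M (\<lambda>n \<omega>. ereal 0) r"
    by (rule O_P_mono[OF O_P_of_rate[where r = r, OF assms(2)]])
       (use assms(2) in \<open>auto intro!: whp_eventually always_eventually\<close>)
  then show ?case by simp
next
  case (insert i I)
  then have "O_P M (\<lambda>n \<omega>. Z i n \<omega> + (\<Sum>i\<in>I. Z i n \<omega>)) r"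
    by (intro O_P_add) auto
  then show ?case using insert by simp
qed

lemma o_1_sum:
  fixes Z :: "'i \<Rightarrow> nat \<Rightarrow> 'w \<Rightarrow> real"
  assumes "finite I" "\<And>i. i \<in> I \<Longrightarrow> o_1 M (Z i)"
  shows "o_1 M (\<lambda>n \<omega>. \<Sum>i\<in>I. Z i n \<omega>)"
  using assms
proof (induction I rule: finite_induct)
  case empty
  then show ?case by (simp add: o_1_def whp_eventually)
next
  case (insert i I)
  then have "o_1 M (\<lambda>n \<omega>. Z i n \<omega> + (\<Sum>i\<in>I. Z i n \<omega>))"
    by (intro o_1_add) auto
  then show ?case using insert by simp
qed

text \<open>Independence and zero means annihilate the mixed products, which leaves n equal
  variances: the moment bound behind Chebyshev's inequality.\<close>

lemma (in prob_space) expectation_square_sum_indep: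
  assumes indep: "indep_vars (\<lambda>_. borel) Y (UNIV :: nat set)"
    and sq: "\<And>i. integrable M (\<lambda>\<omega>. (Y i \<omega>)\<^sup>2)" and mean: "\<And>i. expectation (Y i) = 0"
    and var: "\<And>i. expectation (\<lambda>\<omega>. (Y i \<omega>)\<^sup>2) = v"
  shows "integrable M (\<lambda>\<omega>. (\<Sum>i<n. Y i \<omega>)\<^sup>2)"
    and "expectation (\<lambda>\<omega>. (\<Sum>i<n. Y i \<omega>)\<^sup>2) = real n * v"
proof -
  have meas: "Y i \<in> borel_measurable M" for i
    using indep by (auto simp: indep_vars_def)
  have int: "integrable M (Y i)" for i
    using meas sq by (rule square_integrable_imp_integrable)
  have prod: "integrable M (\<lambda>\<omega>. Y i \<omega> * Y j \<omega>) \<and>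
      expectation (\<lambda>\<omega>. Y i \<omega> * Y j \<omega>) = (if i = j then v else 0)" for i j
  proof (cases "i = j")
    case True
    then show ?thesis using sq var by (simp add: power2_eq_square)
  next
    case False
    have "indep_vars (\<lambda>_. borel) Y {i, j}"
      using indep by (rule indep_vars_subset) simp
    from indep_vars_lebesgue_integral[OF _ this int] indep_vars_integrable[OF _ this int]
    show ?thesis using False mean by simp
  qed
  have eq: "(\<Sum>i<n. Y i \<omega>)\<^sup>2 = (\<Sum>i<n. \<Sum>j<n. Y i \<omega> * Y j \<omega>)" for \<omega>
    by (simp add: power2_eq_square sum_product)
  show "integrable M (\<lambda>\<omega>. (\<Sum>i<n. Y i \<omega>)\<^sup>2)"
    unfolding eq using prod by (intro Bochner_Integration.integrable_sum) blast
  have "expectation (\<lambda>\<omega>. (\<Sum>i<n. Y i \<omega>)\<^sup>2) = (\<Sum>i<n. \<Sum>j<n. if i = j then v else 0)"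
    unfolding eq using prod by (simp add: Bochner_Integration.integral_sum Bochner_Integration.integrable_sum)
  also have "\<dots> = real n * v" by (simp add: sum.delta')
  finally show "expectation (\<lambda>\<omega>. (\<Sum>i<n. Y i \<omega>)\<^sup>2) = real n * v" .
qed

locale iid_sample = prob_space M for M :: "'w measure" +
  fixes X :: "nat \<Rightarrow> 'w \<Rightarrow> 'x" and \<mu> P :: "'x measure"
  assumes indep: "indep_vars (\<lambda>_. \<mu>) X UNIV" and distr: "\<And>i. distr M \<mu> (X i) = P"
begin

lemma X_measurable: "X i \<in> measurable M \<mu>"
  using indep by (auto simp: indep_vars_def)

lemma sets_P: "sets P = sets \<mu>"
  using distr[of 0] by auto

lemma prob_space_P: "prob_space P"
  using prob_space_distr[OF X_measurable[of 0]] distr by simp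

lemma AE_sample: "AE x in P. Q x \<Longrightarrow> AE \<omega> in M. \<forall>i. Q (X i \<omega>)"
  unfolding AE_all_countable using AE_distrD[OF X_measurable] distr by metis

lemma sample_integral:
  fixes f :: "'x \<Rightarrow> real"
  assumes "f \<in> borel_measurable P"
  shows "expectation (\<lambda>\<omega>. f (X i \<omega>)) = integral\<^sup>L P f"
    and "integrable M (\<lambda>\<omega>. f (X i \<omega>)) \<longleftrightarrow> integrable P f"
proof -
  have f: "f \<in> borel_measurable \<mu>"
    using assms measurable_cong_sets[OF sets_P refl] by blast
  show "expectation (\<lambda>\<omega>. f (X i \<omega>)) = integral\<^sup>L P f"
    using integral_distr[OF X_measurable f, of i] distr by simp
  show "integrable M (\<lambda>\<omega>. f (X i \<omega>)) \<longleftrightarrow> integrable P f"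
    using integrable_distr_eq[OF X_measurable f, of i] distr by simp
qed

lemma mean_rate:
  fixes f :: "'x \<Rightarrow> real"
  assumes f: "f \<in> borel_measurable P" "integrable P (\<lambda>x. (f x)\<^sup>2)"
  shows "O_P M (\<lambda>n \<omega>. \<bar>(\<Sum>i<n. f (X i \<omega>)) / n - integral\<^sup>L P f\<bar>) (\<lambda>n. real n powr (-1/2))"
  unfolding O_P_def
proof (intro allI impI)
  fix e :: real assume e: "e > 0"
  interpret P: prob_space P by (rule prob_space_P)
  define h where "h x = f x - integral\<^sup>L P f" for x
  define V where "V = (\<integral>x. (h x)\<^sup>2 \<partial>P)"
  \<comment> \<open>Chebyshev's inequality bounds the probability by V / C^2, which is at most e for
    this C; the summand 1 keeps C positive when V = 0.\<close>
  define C where "C = sqrt (V / e + 1)"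
  have int: "integrable P f" using f by (rule P.square_integrable_imp_integrable)
  have h: "h \<in> borel_measurable P" "integral\<^sup>L P h = 0"
    using f int P.prob_space by (simp_all add: h_def[abs_def])
  have hsq: "integrable P (\<lambda>x. (h x)\<^sup>2)"
    unfolding h_def power2_diff using f int by (intro Bochner_Integration.integrable_add Bochner_Integration.integrable_diff) auto
  have hsq_meas: "(\<lambda>x. (h x)\<^sup>2) \<in> borel_measurable P" using h by simp
  have V: "V \<ge> 0" by (simp add: V_def)
  have C: "C > 0" "C\<^sup>2 = V / e + 1"
    using V e by (simp_all add: C_def add_nonneg_pos)
  have "indep_vars (\<lambda>_. borel) (\<lambda>i \<omega>. h (X i \<omega>)) UNIV"
    by (rule indep_vars_compose2[OF indep]) (use h measurable_cong_sets[OF sets_P refl] in blast)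
  note sq = expectation_square_sum_indep[OF this]
  have hX [measurable]: "(\<lambda>\<omega>. h (X i \<omega>)) \<in> borel_measurable M" for i
    by (rule measurable_compose[OF X_measurable])
      (use h measurable_cong_sets[OF sets_P refl] in blast)
  have sum_sq: "integrable M (\<lambda>\<omega>. (\<Sum>i<n. h (X i \<omega>))\<^sup>2)"
    "expectation (\<lambda>\<omega>. (\<Sum>i<n. h (X i \<omega>))\<^sup>2) = real n * V" for n
    by (rule sq; simp add: sample_integral[OF hsq_meas] sample_integral[OF h(1)] hsq h V_def)+
  have "\<forall>\<^sub>F n in sequentially. outer_measure_of M
      {\<omega> \<in> space M. ereal (C * real n powr (-1/2)) < ereal \<bar>(\<Sum>i<n. f (X i \<omega>)) / n - integral\<^sup>L P f\<bar>}
      \<le> ennreal e"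
    using eventually_gt_at_top[of 0]
  proof eventually_elim
    case (elim n)
    let ?T = "\<lambda>\<omega>. (\<Sum>i<n. h (X i \<omega>))\<^sup>2"
    have "C\<^sup>2 * n \<le> ?T \<omega>" if "C * real n powr (-1/2) < \<bar>(\<Sum>i<n. f (X i \<omega>)) / n - integral\<^sup>L P f\<bar>" for \<omega>
    proof -
      have "(\<Sum>i<n. f (X i \<omega>)) / n - integral\<^sup>L P f = (\<Sum>i<n. h (X i \<omega>)) / n"
        using elim by (simp add: h_def sum_subtractf field_simps)
      moreover have "real n powr (-1/2) * real n = sqrt n"
        using elim by (simp add: powr_minus powr_half_sqrt field_simps)
      ultimately have "C * sqrt n < \<bar>\<Sum>i<n. h (X i \<omega>)\<bar>"
        using that elim by (simp add: abs_divide pos_less_divide_eq mult.assoc)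
      then have "(C * sqrt n)\<^sup>2 \<le> \<bar>\<Sum>i<n. h (X i \<omega>)\<bar>\<^sup>2"
        using C by (intro power_mono) auto
      then show ?thesis by (simp add: power_mult_distrib)
    qed
    then have "outer_measure_of M
      {\<omega> \<in> space M. ereal (C * real n powr (-1/2)) < ereal \<bar>(\<Sum>i<n. f (X i \<omega>)) / n - integral\<^sup>L P f\<bar>}
      \<le> outer_measure_of M {\<omega> \<in> space M. C\<^sup>2 * n \<le> ?T \<omega>}"
      by (intro outer_measure_of_mono) auto
    also have "\<dots> = emeasure M {\<omega> \<in> space M. C\<^sup>2 * n \<le> ?T \<omega>}"
      by (intro outer_measure_of_eq) measurable
    also have "\<dots> \<le> ennreal (1 / (C\<^sup>2 * n) * expectation ?T)"
      using sum_sq(1) by (rule integral_Markov_inequality) (use C(1) elim in auto)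
    also have "1 / (C\<^sup>2 * n) * expectation ?T = V / C\<^sup>2"
      using elim by (simp add: sum_sq)
    also have "ennreal (V / C\<^sup>2) \<le> ennreal e"
    proof (rule ennreal_leI)
      have "V \<le> e * C\<^sup>2" unfolding C(2) using e by (simp add: field_simps)
      then show "V / C\<^sup>2 \<le> e" using C(1) by (simp add: field_simps)
    qed
    finally show ?case .
  qed
  then show "\<exists>C. \<forall>\<^sub>F n in sequentially. outer_measure_of M
      {\<omega> \<in> space M. ereal (C * real n powr (-1/2)) < ereal \<bar>(\<Sum>i<n. f (X i \<omega>)) / n - integral\<^sup>L P f\<bar>}
      \<le> ennreal e" ..
qed

lemma integrable_truncation:
  fixes f :: "'x \<Rightarrow> real"
  assumes f: "integrable P f" and d: "d > 0"
  obtains K :: nat where "(\<integral>x. \<bar>f x - (if \<bar>f x\<bar> \<le> real K then f x else 0)\<bar> \<partial>P) < d"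
proof -
  have meas: "f \<in> borel_measurable P" using f by simp
  have "(\<lambda>K. \<integral>x. \<bar>f x - (if \<bar>f x\<bar> \<le> real K then f x else 0)\<bar> \<partial>P) \<longlonglongrightarrow> (\<integral>x. 0 \<partial>P)"
  proof (rule integral_dominated_convergence[where w = "\<lambda>x. \<bar>f x\<bar>"])
    show "AE x in P. (\<lambda>K. \<bar>f x - (if \<bar>f x\<bar> \<le> real K then f x else 0)\<bar>) \<longlonglongrightarrow> 0"
    proof (rule AE_I2, rule tendsto_eventually)
      fix x
      obtain K :: nat where "\<bar>f x\<bar> \<le> real K" using real_arch_simple by blast
      then show "\<forall>\<^sub>F K in sequentially. \<bar>f x - (if \<bar>f x\<bar> \<le> real K then f x else 0)\<bar> = 0"
        by (intro eventually_mono[OF eventually_ge_at_top[of K]]) auto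
    qed
  qed (use f meas in auto)
  then have "\<forall>\<^sub>F K in sequentially. (\<integral>x. \<bar>f x - (if \<bar>f x\<bar> \<le> real K then f x else 0)\<bar> \<partial>P) < d"
    using d by (intro order_tendstoD) auto
  then show thesis using that by (auto dest: eventually_happens)
qed

text \<open>Without a second moment, truncate: the bounded part obeys Chebyshev's inequality and the remainder is small in mean.\<close>

lemma weak_law:
  fixes f :: "'x \<Rightarrow> real"
  assumes f: "integrable P f"
  shows "o_1 M (\<lambda>n \<omega>. \<bar>(\<Sum>i<n. f (X i \<omega>)) / n - integral\<^sup>L P f\<bar>)"
  unfolding o_1_def whp_def
proof (intro allI impI)
  fix c :: real assume c: "c > 0"
  interpret P: prob_space P by (rule prob_space_P)
  show "(\<lambda>n. outer_measure_of M {\<omega> \<in> space M.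
      \<not> \<bar>(\<Sum>i<n. f (X i \<omega>)) / n - integral\<^sup>L P f\<bar> < c}) \<longlonglongrightarrow> 0"
  proof (rule order_tendstoI)
    fix a :: ennreal assume "0 < a"
    then obtain e where e: "e > 0" "ennreal e < a"
      by (metis dense ennreal_cases ennreal_less_zero_iff less_top_ennreal order_less_trans top.not_eq_extremum)
    \<comment> \<open>The deviation c is split into three parts of size c / 3: the average of f1,
      the average of |f2| and the mean of f2. The first bound serves the mean of f2, the second
      makes Markov's inequality at level c / 3 yield e / 2.\<close>
    define d where "d = min (c / 3) (c * e / 6)"
    have d: "d > 0" using c e by (simp add: d_def)
    obtain K :: nat where K: "(\<integral>x. \<bar>f x - (if \<bar>f x\<bar> \<le> real K then f x else 0)\<bar> \<partial>P) < d"
      by (rule integrable_truncation[OF f d])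
    define f1 where "f1 x = (if \<bar>f x\<bar> \<le> real K then f x else 0)" for x
    define f2 where "f2 x = f x - f1 x" for x
    have meas: "f \<in> borel_measurable P" using f by simp
    then have f1_meas: "f1 \<in> borel_measurable P" unfolding f1_def by measurable
    have f1_sq: "integrable P (\<lambda>x. (f1 x)\<^sup>2)"
    proof (rule P.integrable_const_bound[where B = "(real K)\<^sup>2"])
      show "AE x in P. norm ((f1 x)\<^sup>2) \<le> (real K)\<^sup>2"
        by (intro AE_I2) (auto simp: f1_def abs_le_square_iff[symmetric])
    qed (use f1_meas in simp)
    have f1_int: "integrable P f1"
      using f1_meas f1_sq by (rule P.square_integrable_imp_integrable)
    have f2_int: "integrable P (\<lambda>x. \<bar>f2 x\<bar>)" "integrable P f2"
      unfolding f2_def using f f1_int by auto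
    have f2_small: "(\<integral>x. \<bar>f2 x\<bar> \<partial>P) < d"
      using K by (simp add: f2_def f1_def)
    have f2_mean: "\<bar>integral\<^sup>L P f2\<bar> < c / 3"
      using integral_abs_bound[of P f2] f2_small min.cobounded1[of "c / 3" "c * e / 6"]
      unfolding d_def by linarith
    have "o_1 M (\<lambda>n \<omega>. \<bar>(\<Sum>i<n. f1 (X i \<omega>)) / n - integral\<^sup>L P f1\<bar>)"
      by (rule o_1_powr[OF mean_rate[OF f1_meas f1_sq]]) simp
    then have "whp M (\<lambda>n \<omega>. \<bar>(\<Sum>i<n. f1 (X i \<omega>)) / n - integral\<^sup>L P f1\<bar> < c / 3)"
      by (rule o_1D) (use c in simp)
    then have "\<forall>\<^sub>F n in sequentially. outer_measure_of M
        {\<omega> \<in> space M. \<not> \<bar>(\<Sum>i<n. f1 (X i \<omega>)) / n - integral\<^sup>L P f1\<bar> < c / 3} < ennreal (e / 2)"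
      unfolding whp_def using e by (intro order_tendstoD) auto
    then show "\<forall>\<^sub>F n in sequentially. outer_measure_of M {\<omega> \<in> space M.
      \<not> \<bar>(\<Sum>i<n. f (X i \<omega>)) / n - integral\<^sup>L P f\<bar> < c} < a"
      using eventually_gt_at_top[of 0]
    proof eventually_elim
      case (elim n)
      let ?T = "\<lambda>\<omega>. (\<Sum>i<n. \<bar>f2 (X i \<omega>)\<bar>) / n"
      have abs_meas: "(\<lambda>x. \<bar>f2 x\<bar>) \<in> borel_measurable P" using f2_int(1) by simp
      have [measurable]: "(\<lambda>\<omega>. f2 (X i \<omega>)) \<in> borel_measurable M" for i
        using sample_integral(2) f2_int(2) by (intro borel_measurable_integrable) auto
      have T_int: "integrable M ?T"
        using sample_integral(2)[OF abs_meas] f2_int(1)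
        by (intro integrable_divide_zero Bochner_Integration.integrable_sum) auto
      have "expectation ?T = (\<Sum>i<n. \<integral>x. \<bar>f2 x\<bar> \<partial>P) / n"
        using sample_integral[OF abs_meas] f2_int(1) by (simp add: Bochner_Integration.integral_sum)
      then have T_mean: "expectation ?T = (\<integral>x. \<bar>f2 x\<bar> \<partial>P)" using elim by simp
      have "outer_measure_of M {\<omega> \<in> space M. c / 3 \<le> ?T \<omega>} = emeasure M {\<omega> \<in> space M. c / 3 \<le> ?T \<omega>}"
        by (intro outer_measure_of_eq) measurable
      also have "\<dots> \<le> ennreal (1 / (c / 3) * expectation ?T)"
        using T_int by (rule integral_Markov_inequality) (use c in \<open>auto intro!: divide_nonneg_nonneg sum_nonneg\<close>)
      also have "\<dots> \<le> ennreal (e / 2)"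
        using T_mean f2_small c by (intro ennreal_leI) (simp add: d_def field_simps)
      finally have T_small: "outer_measure_of M {\<omega> \<in> space M. c / 3 \<le> ?T \<omega>} \<le> ennreal (e / 2)" .
      have "\<bar>(\<Sum>i<n. f (X i \<omega>)) / n - integral\<^sup>L P f\<bar> < c"
        if "\<bar>(\<Sum>i<n. f1 (X i \<omega>)) / n - integral\<^sup>L P f1\<bar> < c / 3" "?T \<omega> < c / 3" for \<omega>
      proof -
        have "(\<Sum>i<n. f (X i \<omega>)) / n - integral\<^sup>L P f
            = ((\<Sum>i<n. f1 (X i \<omega>)) / n - integral\<^sup>L P f1) + (\<Sum>i<n. f2 (X i \<omega>)) / n - integral\<^sup>L P f2"
          unfolding f2_def using f f1_int by (simp add: sum_subtractf diff_divide_distrib)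
        moreover have "\<bar>(\<Sum>i<n. f2 (X i \<omega>)) / n\<bar> \<le> ?T \<omega>"
          by (simp add: divide_right_mono)
        ultimately show ?thesis using that f2_mean by linarith
      qed
      then have "outer_measure_of M {\<omega> \<in> space M. \<not> \<bar>(\<Sum>i<n. f (X i \<omega>)) / n - integral\<^sup>L P f\<bar> < c}
        \<le> outer_measure_of M {\<omega> \<in> space M. \<not> \<bar>(\<Sum>i<n. f1 (X i \<omega>)) / n - integral\<^sup>L P f1\<bar> < c / 3}
          + outer_measure_of M {\<omega> \<in> space M. c / 3 \<le> ?T \<omega>}"
        by (intro outer_measure_of_Collect_disj_le) (meson not_le)
      also have "\<dots> \<le> ennreal (e/2) + ennreal (e/2)"
        using elim(1) T_small by (intro add_mono) auto
      also have "\<dots> = ennreal e" using e by (simp flip: ennreal_plus)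
      finally show ?case using e by order
    qed
  qed simp
qed

end

text \<open>If f had mean m different from 0, some combination of centred functions would be closer
  to f than m^2 in mean square. The difference has mean m and second moment below m^2, that is, a
  negative variance.\<close>

lemma closed_linear_span_mean_zero:
  assumes "prob_space P" "A \<subseteq> L2_0 P" "f \<in> closed_linear_span P A"
  shows "integral\<^sup>L P f = 0"
proof (rule ccontr)
  interpret P: prob_space P by fact
  assume "integral\<^sup>L P f \<noteq> 0"
  then have "(integral\<^sup>L P f)\<^sup>2 > 0" by simp
  then obtain F c where F: "finite F" "F \<subseteq> A"
      and lt: "(\<integral>x. (f x - (\<Sum>s\<in>F. c s * s x))\<^sup>2 \<partial>P) < (integral\<^sup>L P f)\<^sup>2"
    using assms(3) unfolding closed_linear_span_def by blast
  have f: "f \<in> borel_measurable P" "integrable P (\<lambda>x. (f x)\<^sup>2)"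
    using assms(3) by (auto simp: closed_linear_span_def L2_def)
  have s: "s \<in> borel_measurable P" "integrable P (\<lambda>x. (s x)\<^sup>2)" "integral\<^sup>L P s = 0" if "s \<in> F" for s
    using that F assms(2) by (auto simp: L2_0_def L2_def)
  have int: "integrable P f" "\<And>s. s \<in> F \<Longrightarrow> integrable P s"
    using f s by (auto intro: P.square_integrable_imp_integrable)
  define h where "h x = f x - (\<Sum>s\<in>F. c s * s x)" for x
  \<comment> \<open>Square integrability of a sum follows from (u + v)^2 \<le> 2 u^2 + 2 v^2; it is
    needed for the combination and for the difference.\<close>
  have sq_diff: "integrable P (\<lambda>x. (u x + v x)\<^sup>2)"
    if "u \<in> borel_measurable P" "v \<in> borel_measurable P"
      "integrable P (\<lambda>x. (u x)\<^sup>2)" "integrable P (\<lambda>x. (v x)\<^sup>2)" for u v :: "'a \<Rightarrow> real"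
  proof (rule Bochner_Integration.integrable_bound)
    show "integrable P (\<lambda>x. 2 * (u x)\<^sup>2 + 2 * (v x)\<^sup>2)" using that by simp
    have "(u x + v x)\<^sup>2 \<le> 2 * (u x)\<^sup>2 + 2 * (v x)\<^sup>2" for x
      using zero_le_power2[of "u x - v x"] by (simp add: power2_eq_square algebra_simps)
    then show "AE x in P. norm ((u x + v x)\<^sup>2) \<le> norm (2 * (u x)\<^sup>2 + 2 * (v x)\<^sup>2)"
      by (intro AE_I2) (simp add: abs_of_nonneg)
  qed (use that in simp)
  have "(\<lambda>x. \<Sum>s\<in>G. c s * s x) \<in> borel_measurable P \<and> integrable P (\<lambda>x. (\<Sum>s\<in>G. c s * s x)\<^sup>2)"
    if "G \<subseteq> F" for G
    using finite_subset[OF that F(1)] that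
  proof (induction G rule: finite_induct)
    case (insert t G)
    have "integrable P (\<lambda>x. (c t * t x + (\<Sum>s\<in>G. c s * s x))\<^sup>2)"
      by (rule sq_diff) (use insert s in \<open>auto simp: power_mult_distrib\<close>)
    then show ?case using insert s by auto
  qed simp
  then have span: "(\<lambda>x. \<Sum>s\<in>F. c s * s x) \<in> borel_measurable P"
      "integrable P (\<lambda>x. (\<Sum>s\<in>F. c s * s x)\<^sup>2)"
    by blast+
  have h: "h \<in> borel_measurable P" "integrable P (\<lambda>x. (h x)\<^sup>2)"
    unfolding h_def using f span sq_diff[of f "\<lambda>x. - (\<Sum>s\<in>F. c s * s x)"] by auto
  have "integral\<^sup>L P h = integral\<^sup>L P f - (\<integral>x. (\<Sum>s\<in>F. c s * s x) \<partial>P)"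
    unfolding h_def using int by (intro Bochner_Integration.integral_diff) auto
  also have "(\<integral>x. (\<Sum>s\<in>F. c s * s x) \<partial>P) = 0"
    using int s by (subst Bochner_Integration.integral_sum) auto
  finally have h_mean: "integral\<^sup>L P h = integral\<^sup>L P f" by simp
  have "0 \<le> P.variance h" by (rule P.variance_positive)
  also have "\<dots> = (\<integral>x. (h x)\<^sup>2 \<partial>P) - (integral\<^sup>L P h)\<^sup>2"
    by (rule P.variance_eq[OF P.square_integrable_imp_integrable[OF h] h(2)])
  finally show False using lt h_mean by (simp add: h_def)
qed

text \<open>Makes the sample mean of the efficient score of order n powr (-1/2) without centring.
  Scores are centred by definition; for the projection this passes from the nuisance scores to their
  closed linear span.\<close>

lemma efficient_score_L2_0:
  assumes "prob_space (model_measure \<mu> lik \<theta>0 \<eta>0)" "is_efficient_score \<mu> lik H \<theta>0 \<eta>0 ell"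
  shows "(\<lambda>x. ell x $ i) \<in> L2_0 (model_measure \<mu> lik \<theta>0 \<eta>0)"
proof -
  define P where "P = model_measure \<mu> lik \<theta>0 \<eta>0"
  interpret P: prob_space P using assms(1) by (simp add: P_def)
  let ?N = "nuisance_scores \<mu> lik H \<theta>0 \<eta>0"
  obtain s p where s: "is_theta_score \<mu> lik \<theta>0 \<eta>0 s"
    and p: "is_L2_projection P (closed_linear_span P ?N) (\<lambda>x. s x $ i) (\<lambda>x. p x $ i)"
    and ell: "ell \<in> borel_measurable P" "AE x in P. ell x = s x - p x"
    using assms(2) unfolding is_efficient_score_def P_def[symmetric] Let_def by blast
  have si: "(\<lambda>x. s x $ i) \<in> L2_0 P"
    using s by (simp add: is_theta_score_def P_def Let_def)
  have pi: "(\<lambda>x. p x $ i) \<in> closed_linear_span P ?N"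
    using p by (simp add: is_L2_projection_def)
  have "?N \<subseteq> L2_0 P" by (auto simp: nuisance_scores_def P_def Let_def)
  with pi have p_mean: "(\<integral>x. p x $ i \<partial>P) = 0"
    using closed_linear_span_mean_zero P.prob_space_axioms by blast
  have s2: "(\<lambda>x. s x $ i) \<in> borel_measurable P" "integrable P (\<lambda>x. (s x $ i)\<^sup>2)" "(\<integral>x. s x $ i \<partial>P) = 0"
    using si by (auto simp: L2_0_def L2_def)
  have p2: "(\<lambda>x. p x $ i) \<in> borel_measurable P" "integrable P (\<lambda>x. (p x $ i)\<^sup>2)"
    using pi by (auto simp: closed_linear_span_def L2_def)
  have int: "integrable P (\<lambda>x. s x $ i)" "integrable P (\<lambda>x. p x $ i)"
    using s2 p2 by (auto intro: P.square_integrable_imp_integrable)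
  have meas: "(\<lambda>x. ell x $ i) \<in> borel_measurable P"
    by (rule measurable_compose[OF ell(1)])
      (intro borel_measurable_continuous_onI continuous_intros)
  have eq: "AE x in P. ell x $ i = s x $ i - p x $ i" using ell(2) by eventually_elim simp
  have "(\<integral>x. ell x $ i \<partial>P) = (\<integral>x. s x $ i - p x $ i \<partial>P)"
    by (rule integral_cong_AE) (use meas s2 p2 eq in auto)
  also have "\<dots> = 0" using int s2 p_mean by simp
  finally have mean: "(\<integral>x. ell x $ i \<partial>P) = 0" .
  have "integrable P (\<lambda>x. (ell x $ i)\<^sup>2)"
  proof (rule Bochner_Integration.integrable_bound)
    show "integrable P (\<lambda>x. 2 * (s x $ i)\<^sup>2 + 2 * (p x $ i)\<^sup>2)" using s2 p2 by simp
    show "(\<lambda>x. (ell x $ i)\<^sup>2) \<in> borel_measurable P" using meas by simp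
    show "AE x in P. norm ((ell x $ i)\<^sup>2) \<le> norm (2 * (s x $ i)\<^sup>2 + 2 * (p x $ i)\<^sup>2)"
      using eq
    proof eventually_elim
      case (elim x)
      have "(s x $ i - p x $ i)\<^sup>2 \<le> 2 * (s x $ i)\<^sup>2 + 2 * (p x $ i)\<^sup>2"
        using zero_le_power2[of "s x $ i + p x $ i"] by (simp add: power2_eq_square algebra_simps)
      then show ?case using elim by (simp add: abs_of_nonneg)
    qed
  qed
  with meas mean show ?thesis by (simp add: L2_0_def L2_def P_def)
qed

section \<open>The rate sequences\<close>

text \<open>Removes the logarithms: \<open>int_ge\<close> and \<open>int_gt\<close> become the first
  exponents at which a power of 2 reaches, respectively exceeds, y.\<close>

lemma ln_ratio_le_iff: "y > 0 \<Longrightarrow> ln y / ln 2 \<le> real m \<longleftrightarrow> y \<le> 2 ^ m"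
  by (simp add: pos_divide_le_eq flip: ln_realpow)

lemma int_ge_ln: "y > 0 \<Longrightarrow> y \<le> 2 ^ int_ge (ln y / ln 2)"
  unfolding ln_ratio_le_iff[symmetric] int_ge_def by (rule LeastI_ex) (rule real_arch_simple)

lemma less_int_ge_ln: "y > 0 \<Longrightarrow> k < int_ge (ln y / ln 2) \<Longrightarrow> 2 ^ k < y"
  using not_less_Least[of k "\<lambda>m. ln y / ln 2 \<le> real m"] ln_ratio_le_iff[of y k]
  unfolding int_ge_def by linarith

lemma int_gt_ln: "y > 0 \<Longrightarrow> y < 2 ^ int_gt (ln y / ln 2)"
proof -
  assume y: "y > 0"
  have "ln y / ln 2 < real (int_gt (ln y / ln 2))"
    unfolding int_gt_def by (rule LeastI_ex) (rule reals_Archimedean2)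
  then have "ln y < ln (2 ^ int_gt (ln y / ln 2))"
    by (simp add: pos_divide_less_eq ln_realpow)
  then show ?thesis using y by simp
qed

lemma increases_to_infinity_fromI:
  assumes "r 0 = a" "c > 0" and step: "\<And>k. r k + c \<le> r (Suc k)"
  shows "increases_to_infinity_from r a"
proof -
  have "strict_mono r"
    unfolding strict_mono_Suc_iff using step \<open>c > 0\<close> by (smt (verit))
  moreover have "a + real k * c \<le> r k" for k
  proof (induction k)
    case (Suc k)
    then show ?case using step[of k] by (simp add: algebra_simps)
  qed (simp add: assms)
  moreover have "filterlim (\<lambda>k. a + real k * c) at_top sequentially"
    using \<open>c > 0\<close>
    by (intro filterlim_tendsto_add_at_top[OF tendsto_const]
        filterlim_at_top_mult_tendsto_pos[OF tendsto_const] filterlim_real_sequentially)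
  ultimately show ?thesis
    using assms(1) by (auto simp: increases_to_infinity_from_def intro: filterlim_at_top_mono)
qed

context
  fixes \<psi> g :: real
  assumes g: "g > 0" "g \<le> 1/2" and \<psi>: "1/2 - g < \<psi>" "\<psi> \<le> 1/2"
begin

text \<open>With the next lemma: \<open>L1 \<psi> g\<close> is the first k at which the doubling
  increment 2^k (\<psi> + g - 1/2) reaches g.\<close>

lemma L1_bound: "g \<le> 2 ^ L1 \<psi> g * (\<psi> + g - 1/2)"
  using int_ge_ln[of "g / (g + \<psi> - 1/2)"] g \<psi>
  by (simp add: L1_def pos_divide_le_eq algebra_simps)

lemma less_L1: "k < L1 \<psi> g \<Longrightarrow> 2 ^ k * (\<psi> + g - 1/2) < g"
  using less_int_ge_ln[of "g / (g + \<psi> - 1/2)" k] g \<psi>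
  by (simp add: L1_def pos_less_divide_eq algebra_simps)

lemma R_0: "R \<psi> g 0 = \<psi>"
  by (simp add: R_def R1_def)

text \<open>Both regimes of \<open>R\<close> in terms of increments, which double until they reach g
  and equal g from then on. All later facts on \<open>R\<close> are read off from this form.\<close>

lemma R_Suc: "R \<psi> g (Suc k) = R \<psi> g k + (if k < L1 \<psi> g then 2 ^ k * (\<psi> + g - 1/2) else g)"
proof -
  consider "k < L1 \<psi> g" | "k = L1 \<psi> g" | "k > L1 \<psi> g" by linarith
  then show ?thesis
  proof cases
    case 3
    then have "Suc k - L1 \<psi> g = Suc (k - L1 \<psi> g)" by simp
    with 3 show ?thesis by (simp add: R_def R2_def algebra_simps)
  qed (auto simp: R_def R1_def R2_def algebra_simps)
qed

lemma R_step:
  shows "R \<psi> g k + min (\<psi> + g - 1/2) g \<le> R \<psi> g (Suc k)" and "R \<psi> g (Suc k) \<le> R \<psi> g k + g"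
proof -
  have "1 * (\<psi> + g - 1/2) \<le> 2 ^ k * (\<psi> + g - 1/2)"
    using \<psi> by (intro mult_right_mono) auto
  then show "R \<psi> g k + min (\<psi> + g - 1/2) g \<le> R \<psi> g (Suc k)"
    by (simp add: R_Suc min.coboundedI1)
  show "R \<psi> g (Suc k) \<le> R \<psi> g k + g"
    by (auto simp: R_Suc intro: less_imp_le less_L1)
qed

lemma R_increases: "increases_to_infinity_from (R \<psi> g) \<psi>"
  by (rule increases_to_infinity_fromI[OF R_0 _ R_step(1)]) (use g \<psi> in auto)

lemma R_mono: "k \<le> l \<Longrightarrow> R \<psi> g k \<le> R \<psi> g l"
  using R_increases unfolding increases_to_infinity_from_def by (meson strict_mono_less_eq)

lemma R_pos: "R \<psi> g k > 0"
  using R_mono[of 0 k] R_0 g \<psi> by simp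

lemma R_L1: "1/2 \<le> R \<psi> g (L1 \<psi> g)"
  using L1_bound by (simp add: R_def R1_def)

text \<open>Before \<open>L1\<close> the increment is R - (1/2 - g), at most R since g \<le> 1/2.
  From \<open>L1\<close> on it is g \<le> 1/2, and R has reached 1/2 there.\<close>

lemma R_Suc_le_double: "R \<psi> g (Suc k) \<le> 2 * R \<psi> g k"
proof (cases "k < L1 \<psi> g")
  case True
  then show ?thesis using g by (simp add: R_Suc) (simp add: R_def R1_def)
next
  case False
  then have "1/2 \<le> R \<psi> g k"
    using R_L1 R_mono[of "L1 \<psi> g" k] by simp
  then show ?thesis using False g by (simp add: R_Suc)
qed

text \<open>The two thresholds differ only if g / (g + \<psi> - 1/2) is a power of 2. Then R equals
  1/2 exactly at \<open>L1\<close>, and one more step, worth g, makes the inequality strict.\<close>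

lemma R_L1_tilde: "1/2 < R \<psi> g (L1_tilde \<psi> g)"
proof (cases "L1_tilde \<psi> g \<le> L1 \<psi> g")
  case True
  have "g < 2 ^ L1_tilde \<psi> g * (\<psi> + g - 1/2)"
    using int_gt_ln[of "g / (g + \<psi> - 1/2)"] g \<psi>
    by (simp add: L1_tilde_def pos_divide_less_eq algebra_simps)
  with True show ?thesis by (simp add: R_def R1_def)
next
  case False
  then have "R \<psi> g (Suc (L1 \<psi> g)) \<le> R \<psi> g (L1_tilde \<psi> g)"
    by (intro R_mono) simp
  then show ?thesis using R_L1 g by (simp add: R_Suc)
qed

end

section \<open>The profile likelihood estimator\<close>

theorem theorem3:
  fixes M :: "'w measure" and X :: "nat \<Rightarrow> 'w \<Rightarrow> 'x"
    and \<mu> :: "'x measure" and lik :: "real ^ 'd::finite \<Rightarrow> 'h \<Rightarrow> 'x \<Rightarrow> real"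
    and \<Theta> N :: "(real ^ 'd) set" and H :: "'h set"
    and \<theta>0 :: "real ^ 'd" and \<eta>0 :: 'h
    and \<eta>s :: "real ^ 'd \<Rightarrow> 'h" and \<eta>hat :: "nat \<Rightarrow> 'w \<Rightarrow> real ^ 'd \<Rightarrow> 'h"
    and ell :: "'x \<Rightarrow> real ^ 'd" and \<theta>hat :: "nat \<Rightarrow> 'w \<Rightarrow> real ^ 'd" and g :: real
  defines "P0 \<equiv> model_measure \<mu> lik \<theta>0 \<eta>0"
    and "I0 \<equiv> covariance_matrix (model_measure \<mu> lik \<theta>0 \<eta>0) ell"
    and "S \<equiv> \<lambda>n \<omega>. loglik_sum lik X n \<omega> \<eta>s"
    and "Shat \<equiv> \<lambda>n \<omega>. loglik_sum lik X n \<omega> (\<eta>hat n \<omega>)"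
    and "lfs \<equiv> \<lambda>x t. ln (lik t (\<eta>s t) x)"
  assumes model: "semiparametric_model \<mu> lik \<Theta> H" "\<theta>0 \<in> \<Theta>" "\<eta>0 \<in> H"
    and iid: "prob_space M" "prob_space.indep_vars M (\<lambda>_. \<mu>) X UNIV" "\<And>i. distr M \<mu> (X i) = P0"
    and nbhd: "open N" "\<theta>0 \<in> N" "N \<subseteq> \<Theta>"
    and lf_curve: "least_favorable_curve \<mu> lik \<Theta> H \<theta>0 \<eta>0 \<eta>s"
    and eff_score: "is_efficient_score \<mu> lik H \<theta>0 \<eta>0 ell"
    and lfs_smooth: "AE x in P0. \<forall>t\<in>N. 0 < lik t (\<eta>s t) x \<and> twice_differentiable (lfs x) t"
    and lfs_score: "AE x in P0. grad (lfs x) \<theta>0 = ell x"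
    and lfs_info: "\<And>i j. integrable P0 (\<lambda>x. hess (lfs x) \<theta>0 $ i $ j)"
      "\<And>i j. I0 $ i $ j = - (\<integral>x. hess (lfs x) \<theta>0 $ i $ j \<partial>P0)"
    and Shat_smooth: "AE \<omega> in M. \<forall>n. \<forall>\<theta>\<in>N. lik_pos lik X n \<omega> (\<eta>hat n \<omega>) \<theta> \<and>
      thrice_differentiable (Shat n \<omega>) \<theta>"
    and \<theta>hat_max: "AE \<omega> in M. \<forall>n\<ge>1. is_profile_maximizer lik X n \<omega> (\<eta>hat n \<omega>) \<Theta> (\<theta>hat n \<omega>)"
    and g: "1/4 < g" "g \<le> 1/2"
    and G1: "O_P M (\<lambda>n \<omega>. norm (grad (Shat n \<omega>) \<theta>0 /\<^sub>R n - grad (S n \<omega>) \<theta>0 /\<^sub>R n))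
      (\<lambda>n. real n powr (- 2 * g))"
    and G2: "O_P M (\<lambda>n \<omega>. SUP \<theta>\<in>N. ereal (norm (hess (Shat n \<omega>) \<theta> /\<^sub>R n - hess (S n \<omega>) \<theta> /\<^sub>R n)))
      (\<lambda>n. real n powr (- g))"
    and G3: "O_P M (\<lambda>n \<omega>. SUP \<theta>\<in>N. ereal (onorm (\<lambda>h. third (Shat n \<omega>) \<theta> h /\<^sub>R n))) (\<lambda>n. 1)"
    and consistent: "o_P M (\<lambda>n \<omega>. norm (\<theta>hat n \<omega> - \<theta>0)) (\<lambda>n. 1)"
    and nonsingular: "invertible I0"
  shows "((\<forall>i j. integrable P0 (\<lambda>x. (hess (lfs x) \<theta>0 $ i $ j)\<^sup>2)) \<longrightarrow>
      O_P M (\<lambda>n \<omega>. norm (sqrt n *\<^sub>R (\<theta>hat n \<omega> - \<theta>0)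
          - (1 / sqrt n) *\<^sub>R (\<Sum>i<n. matrix_inv I0 *v ell (X i \<omega>))))
        (\<lambda>n. real n powr (1/2 - 2 * g)))
    \<and> (\<forall>\<psi> (\<theta>init :: nat \<Rightarrow> 'w \<Rightarrow> real ^ 'd).
        1/2 - g < \<psi> \<and> \<psi> \<le> 1/2 \<and>
        O_P M (\<lambda>n \<omega>. norm (\<theta>init n \<omega> - \<theta>0)) (\<lambda>n. real n powr (- \<psi>)) \<longrightarrow>
          (\<forall>k. O_P M
            (\<lambda>n \<omega>. norm (iterate I_hat_hess n (Shat n \<omega>) (\<theta>init n \<omega>) k - \<theta>hat n \<omega>))
            (\<lambda>n. real n powr (- (2 ^ k * \<psi>))))
        \<and> increases_to_infinity_from (\<lambda>k. 2 ^ k * \<psi>) \<psi>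
        \<and> o_P M
            (\<lambda>n \<omega>. norm (iterate I_hat_hess n (Shat n \<omega>) (\<theta>init n \<omega>)
               (int_gt (ln (1 / (2 * \<psi>)) / ln 2)) - \<theta>hat n \<omega>))
            (\<lambda>n. real n powr (- 1/2))
        \<and> (\<forall>t1 t2. t1 < t2 \<longrightarrow>
            (\<forall>k. O_P M
              (\<lambda>n \<omega>. norm (iterate (I_hat_diff t1 t2) n (Shat n \<omega>) (\<theta>init n \<omega>) k - \<theta>hat n \<omega>))
              (\<lambda>n. real n powr (- R \<psi> g k)))
            \<and> o_P M
              (\<lambda>n \<omega>. norm (iterate (I_hat_diff t1 t2) n (Shat n \<omega>) (\<theta>init n \<omega>) (L1_tilde \<psi> g)
                 - \<theta>hat n \<omega>))
              (\<lambda>n. real n powr (- 1/2)))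
        \<and> increases_to_infinity_from (R \<psi> g) \<psi>)"
proof -

  \<comment> \<open>Random Lipschitz constant of the Hessian\<close>
  interpret iid_sample M X \<mu> P0
    using iid by (intro iid_sample.intro iid_sample_axioms.intro)
  obtain \<rho> where \<rho>: "\<rho> > 0" "ball \<theta>0 \<rho> \<subseteq> N"
    using nbhd open_contains_ball by blast
  \<comment> \<open>\<open>onorm\<close> is a supremum of reals, hence of unspecified sign where \<open>third\<close> is not a derivative.\<close>
  define W where "W n \<omega> = max 0 (SUP \<theta>\<in>N. ereal (onorm (\<lambda>h. third (Shat n \<omega>) \<theta> h /\<^sub>R n)))" for n \<omega>
  define \<Lambda> where "\<Lambda> n \<omega> = real_of_ereal (W n \<omega>)" for n \<omega>
  have W_nonneg: "0 \<le> W n \<omega>" for n \<omega>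
    by (simp add: W_def)
  \<comment> \<open>The constant supplied by Condition G may be negative, hence
    \<open>max 0 B\<close>; the binary rule is fed the same bound twice.\<close>
  have W: "O_P M W (\<lambda>n. 1)"
  proof (rule O_P_combine[OF G3 G3], goal_cases)
    case (1 B C)
    have "W n \<omega> \<le> ereal (max 0 B * 1)"
      if "(SUP \<theta>\<in>N. ereal (onorm (\<lambda>h. third (Shat n \<omega>) \<theta> h /\<^sub>R n))) \<le> ereal (B * 1)" for n \<omega>
    proof -
      have "ereal (B * 1) \<le> ereal (max 0 B * 1)" "0 \<le> ereal (max 0 B * 1)"
        by (simp_all add: le_max_iff_disj)
      with that show ?thesis unfolding W_def by (meson max.boundedI order_trans)
    qed
    then show ?case by (intro exI[of _ "max 0 B"] always_eventually) blast
  qed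
  have \<Lambda>: "O_P M (\<lambda>n \<omega>. \<Lambda> n \<omega>) (\<lambda>n. 1)" "whp M (\<lambda>n \<omega>. W n \<omega> = ereal (\<Lambda> n \<omega>))"
    using O_P_real_of_ereal[OF W W_nonneg] by (simp_all add: \<Lambda>_def)
  have \<Lambda>_nonneg: "0 \<le> \<Lambda> n \<omega>" for n \<omega>
    using W_nonneg by (simp add: \<Lambda>_def real_of_ereal_pos)
  have smooth: "whp M (\<lambda>n \<omega>. \<forall>\<theta>\<in>N. lik_pos lik X n \<omega> (\<eta>hat n \<omega>) \<theta> \<and> thrice_differentiable (Shat n \<omega>) \<theta>)"
    using Shat_smooth by (intro whp_AE[where k = 0]) simp
  have lipschitz: "whp M (\<lambda>n \<omega>. lipschitz_score n (Shat n \<omega>) (ball \<theta>0 \<rho>) (\<Lambda> n \<omega>))"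
    using smooth \<Lambda>(2)
  proof (rule whp_mono2)
    fix n \<omega>
    assume 1: "\<forall>\<theta>\<in>N. lik_pos lik X n \<omega> (\<eta>hat n \<omega>) \<theta> \<and> thrice_differentiable (Shat n \<omega>) \<theta>"
      and 2: "W n \<omega> = ereal (\<Lambda> n \<omega>)"
    have "onorm (\<lambda>h. third (Shat n \<omega>) \<theta> h /\<^sub>R n) \<le> \<Lambda> n \<omega>" if "\<theta> \<in> N" for \<theta>
    proof -
      have "ereal (onorm (\<lambda>h. third (Shat n \<omega>) \<theta> h /\<^sub>R n)) \<le> W n \<omega>"
        unfolding W_def using that by (intro max.coboundedI2 SUP_upper)
      then show ?thesis by (simp add: 2)
    qed
    then show "lipschitz_score n (Shat n \<omega>) (ball \<theta>0 \<rho>) (\<Lambda> n \<omega>)"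
      using 1 \<rho>(2) by (intro lipschitz_score_third convex_ball) auto
  qed

  \<comment> \<open>First-order condition at the maximizer\<close>
  have consistent': "o_1 M (\<lambda>n \<omega>. norm (\<theta>hat n \<omega> - \<theta>0))"
    using consistent by (simp only: o_1_iff_o_P)
  have max: "whp M (\<lambda>n \<omega>. is_profile_maximizer lik X n \<omega> (\<eta>hat n \<omega>) \<Theta> (\<theta>hat n \<omega>))"
    using \<theta>hat_max by (rule whp_AE)
  \<comment> \<open>With high probability \<theta>hat lies in the ball. Every point of the ball is
    an admissible competitor, by N \<subseteq> \<Theta> and positivity of the likelihoods, so the
    constrained maximizer is an interior one.\<close>
  have crit: "whp M (\<lambda>n \<omega>. grad (Shat n \<omega>) (\<theta>hat n \<omega>) = 0)"
    using whp_conj[OF smooth max] o_1D[OF consistent' \<rho>(1)]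
  proof (rule whp_mono2)
    fix n \<omega>
    assume *: "(\<forall>\<theta>\<in>N. lik_pos lik X n \<omega> (\<eta>hat n \<omega>) \<theta> \<and> thrice_differentiable (Shat n \<omega>) \<theta>)
        \<and> is_profile_maximizer lik X n \<omega> (\<eta>hat n \<omega>) \<Theta> (\<theta>hat n \<omega>)"
      and near: "norm (\<theta>hat n \<omega> - \<theta>0) < \<rho>"
    show "grad (Shat n \<omega>) (\<theta>hat n \<omega>) = 0"
    proof (rule grad_local_max[OF open_ball])
      show in_ball: "\<theta>hat n \<omega> \<in> ball \<theta>0 \<rho>"
        using near by (simp add: dist_norm norm_minus_commute)
      show "Shat n \<omega> differentiable (at (\<theta>hat n \<omega>))"
        using * in_ball \<rho>(2) by (auto simp: thrice_differentiable_def twice_differentiable_def)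
      show "Shat n \<omega> t \<le> Shat n \<omega> (\<theta>hat n \<omega>)" if "t \<in> ball \<theta>0 \<rho>" for t
      proof -
        have "t \<in> \<Theta> \<and> lik_pos lik X n \<omega> (\<eta>hat n \<omega>) t"
          using that * \<rho>(2) nbhd(3) by blast
        then show ?thesis
          using * unfolding is_profile_maximizer_def is_arg_max_def Shat_def by (meson not_le)
      qed
    qed
  qed

  \<comment> \<open>Score at the true parameter\<close>
  have sample: "AE \<omega> in M. \<forall>i. (\<forall>t\<in>N. twice_differentiable (lfs (X i \<omega>)) t)
      \<and> grad (lfs (X i \<omega>)) \<theta>0 = ell (X i \<omega>)"
    by (rule AE_sample) (use lfs_smooth lfs_score in eventually_elim, blast)
  have S_eq: "S n \<omega> = (\<lambda>\<theta>. \<Sum>i<n. lfs (X i \<omega>) \<theta>)" for n \<omega>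
    by (simp add: fun_eq_iff S_def lfs_def loglik_sum_def)
  have S_derivs: "whp M (\<lambda>n \<omega>. grad (S n \<omega>) \<theta>0 = (\<Sum>i<n. ell (X i \<omega>))
      \<and> hess (S n \<omega>) \<theta>0 = (\<Sum>i<n. hess (lfs (X i \<omega>)) \<theta>0))"
  proof (rule whp_AE[where k = 0], use sample in eventually_elim)
    fix \<omega>
    assume *: "\<forall>i. (\<forall>t\<in>N. twice_differentiable (lfs (X i \<omega>)) t) \<and> grad (lfs (X i \<omega>)) \<theta>0 = ell (X i \<omega>)"
    have "grad (S n \<omega>) \<theta>0 = (\<Sum>i<n. ell (X i \<omega>))" for n
      unfolding S_eq using * nbhd(2) by (subst grad_sum) (auto simp: twice_differentiable_def)
    moreover have "hess (S n \<omega>) \<theta>0 = (\<Sum>i<n. hess (lfs (X i \<omega>)) \<theta>0)" for n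
      unfolding S_eq using * nbhd by (intro hess_sum[of N]) auto
    ultimately show "\<forall>n\<ge>0. grad (S n \<omega>) \<theta>0 = (\<Sum>i<n. ell (X i \<omega>))
      \<and> hess (S n \<omega>) \<theta>0 = (\<Sum>i<n. hess (lfs (X i \<omega>)) \<theta>0)"
      by blast
  qed
  have ell_L2: "(\<lambda>x. ell x $ i) \<in> L2_0 P0" for i
    using eff_score prob_space_P unfolding P0_def by (intro efficient_score_L2_0)
  have score_S: "O_P M (\<lambda>n \<omega>. norm (grad (S n \<omega>) \<theta>0 /\<^sub>R n)) (\<lambda>n. real n powr (-1/2))"
  proof (rule O_P_mono)
    show "O_P M (\<lambda>n \<omega>. \<Sum>j\<in>UNIV. \<bar>(\<Sum>i<n. ell (X i \<omega>) $ j) / n - (\<integral>x. ell x $ j \<partial>P0)\<bar>)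
        (\<lambda>n. real n powr (-1/2))"
      using ell_L2 by (intro O_P_sum mean_rate) (auto simp: L2_0_def L2_def)
    show "whp M (\<lambda>n \<omega>. ereal (norm (grad (S n \<omega>) \<theta>0 /\<^sub>R n))
        \<le> ereal (\<Sum>j\<in>UNIV. \<bar>(\<Sum>i<n. ell (X i \<omega>) $ j) / n - (\<integral>x. ell x $ j \<partial>P0)\<bar>))"
      using S_derivs
    proof (rule whp_mono)
      fix n \<omega>
      assume "grad (S n \<omega>) \<theta>0 = (\<Sum>i<n. ell (X i \<omega>))
        \<and> hess (S n \<omega>) \<theta>0 = (\<Sum>i<n. hess (lfs (X i \<omega>)) \<theta>0)"
      then have "norm (grad (S n \<omega>) \<theta>0 /\<^sub>R n) \<le> (\<Sum>j\<in>UNIV. \<bar>((\<Sum>i<n. ell (X i \<omega>)) /\<^sub>R n) $ j\<bar>)"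
        using norm_le_l1_cart[of "(\<Sum>i<n. ell (X i \<omega>)) /\<^sub>R n"] by simp
      also have "\<dots> = (\<Sum>j\<in>UNIV. \<bar>(\<Sum>i<n. ell (X i \<omega>) $ j) / n - (\<integral>x. ell x $ j \<partial>P0)\<bar>)"
        using ell_L2 by (intro sum.cong refl) (simp add: L2_0_def divide_inverse mult.commute)
      finally show "ereal (norm (grad (S n \<omega>) \<theta>0 /\<^sub>R n))
        \<le> ereal (\<Sum>j\<in>UNIV. \<bar>(\<Sum>i<n. ell (X i \<omega>) $ j) / n - (\<integral>x. ell x $ j \<partial>P0)\<bar>)"
        by simp
    qed
  qed
  have score: "O_P M (\<lambda>n \<omega>. norm (ell_hat n (Shat n \<omega>) \<theta>0)) (\<lambda>n. real n powr (-1/2))"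
  proof (rule O_P_mono[OF O_P_add[OF O_P_powr_mono[OF G1] score_S]])
    \<comment> \<open>Here 1/4 < g enters: replacing the estimated by the true least favorable curve
      costs less than the sampling error of the score.\<close>
    show "- 2 * g \<le> -1/2" using g by simp
    show "whp M (\<lambda>n \<omega>. ereal (norm (ell_hat n (Shat n \<omega>) \<theta>0))
        \<le> ereal (norm (grad (Shat n \<omega>) \<theta>0 /\<^sub>R n - grad (S n \<omega>) \<theta>0 /\<^sub>R n) + norm (grad (S n \<omega>) \<theta>0 /\<^sub>R n)))"
      by (intro whp_eventually always_eventually allI ballI)
        (simp only: ell_hat_def ereal_less_eq add.commute norm_triangle_sub)
  qed

  \<comment> \<open>Hessian at the true parameter\<close>
  define HD where "HD n \<omega> = (\<Sum>j\<in>UNIV. \<Sum>k\<in>UNIV.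
      \<bar>(\<Sum>i<n. hess (lfs (X i \<omega>)) \<theta>0 $ j $ k) / n - (\<integral>x. hess (lfs x) \<theta>0 $ j $ k \<partial>P0)\<bar>)" for n \<omega>
  have hess_diff: "O_P M (\<lambda>n \<omega>. norm (hess (Shat n \<omega>) \<theta>0 /\<^sub>R n - hess (S n \<omega>) \<theta>0 /\<^sub>R n))
      (\<lambda>n. real n powr (- g))"
    using G2 by (rule O_P_mono)
      (intro whp_eventually always_eventually allI ballI SUP_upper[of \<theta>0 N, OF nbhd(2)])
  \<comment> \<open>Kept as an inequality because \<open>HD\<close> is estimated twice: by the weak
    law for consistency of the Hessian, and by second moments for its rate in the expansion.\<close>
  have hess_bound: "whp M (\<lambda>n \<omega>. norm (hess (Shat n \<omega>) \<theta>0 /\<^sub>R n + I0)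
      \<le> norm (hess (Shat n \<omega>) \<theta>0 /\<^sub>R n - hess (S n \<omega>) \<theta>0 /\<^sub>R n) + HD n \<omega>)"
    using S_derivs
  proof (rule whp_mono)
    fix n \<omega>
    assume "grad (S n \<omega>) \<theta>0 = (\<Sum>i<n. ell (X i \<omega>))
      \<and> hess (S n \<omega>) \<theta>0 = (\<Sum>i<n. hess (lfs (X i \<omega>)) \<theta>0)"
    then have hess_S: "hess (S n \<omega>) \<theta>0 = (\<Sum>i<n. hess (lfs (X i \<omega>)) \<theta>0)" ..
    have "norm (hess (S n \<omega>) \<theta>0 /\<^sub>R n + I0)
        \<le> (\<Sum>j\<in>UNIV. \<Sum>k\<in>UNIV. \<bar>(hess (S n \<omega>) \<theta>0 /\<^sub>R n + I0) $ j $ k\<bar>)"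
      by (rule norm_matrix_le_component_sum)
    also have "\<dots> = HD n \<omega>"
      unfolding HD_def hess_S
      by (intro sum.cong refl) (simp add: lfs_info(2) divide_inverse mult.commute)
    finally show "norm (hess (Shat n \<omega>) \<theta>0 /\<^sub>R n + I0)
      \<le> norm (hess (Shat n \<omega>) \<theta>0 /\<^sub>R n - hess (S n \<omega>) \<theta>0 /\<^sub>R n) + HD n \<omega>"
      using norm_triangle_ineq[of "hess (Shat n \<omega>) \<theta>0 /\<^sub>R n - hess (S n \<omega>) \<theta>0 /\<^sub>R n"
          "hess (S n \<omega>) \<theta>0 /\<^sub>R n + I0"] by simp
  qed
  have "o_1 M HD"
    unfolding HD_def using lfs_info(1) by (intro o_1_sum weak_law) auto
  then have hess0: "o_1 M (\<lambda>n \<omega>. norm (hess (Shat n \<omega>) \<theta>0 /\<^sub>R n + I0))"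
    by (rule o_1_mono[OF o_1_add[OF o_1_powr[OF hess_diff]] hess_bound, rotated]) (use g in simp)
  interpret profile_iteration M Shat \<theta>0 \<theta>hat I0 \<rho> \<Lambda>
    by unfold_locales (fact \<rho>(1) lipschitz \<Lambda>(1) \<Lambda>_nonneg hess0 nonsingular consistent' crit score)+

  \<comment> \<open>Asymptotic expansion of the maximizer\<close>
  have expansion: "O_P M (\<lambda>n \<omega>. norm (sqrt n *\<^sub>R (\<theta>hat n \<omega> - \<theta>0)
      - (1 / sqrt n) *\<^sub>R (\<Sum>i<n. matrix_inv I0 *v ell (X i \<omega>))))
    (\<lambda>n. real n powr (1/2 - 2 * g))"
    if sq: "\<forall>i j. integrable P0 (\<lambda>x. (hess (lfs x) \<theta>0 $ i $ j)\<^sup>2)"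
  proof -
    let ?d = "\<lambda>n \<omega>. \<theta>hat n \<omega> - \<theta>0"
    let ?H = "\<lambda>n \<omega>. hess (Shat n \<omega>) \<theta>0 /\<^sub>R n"
    let ?U = "\<lambda>n \<omega>. grad (Shat n \<omega>) \<theta>0 /\<^sub>R n - grad (S n \<omega>) \<theta>0 /\<^sub>R n"
    \<comment> \<open>Its three terms are the error of the Hessian, the Taylor remainder and the
      difference of the two scores at \<theta>0; each is of order n powr (-2 g).\<close>
    let ?B = "\<lambda>n \<omega>. norm (?H n \<omega> + I0) * norm (?d n \<omega>)
      + (\<Lambda> n \<omega> * (norm (?d n \<omega>) * norm (?d n \<omega>)) + norm (?U n \<omega>))"
    have "O_P M HD (\<lambda>n. real n powr (-1/2))"
      unfolding HD_def using lfs_info(1) sq by (intro O_P_sum mean_rate) auto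
    then have "O_P M HD (\<lambda>n. real n powr (- g))"
      by (rule O_P_powr_mono) (use g in simp)
    from O_P_mono[OF O_P_add[OF hess_diff this]] hess_bound
    have "O_P M (\<lambda>n \<omega>. norm (?H n \<omega> + I0)) (\<lambda>n. real n powr (- g))" by simp
    \<comment> \<open>The product has order n powr (- g - 1/2), at most n powr (-2 g) since g \<le>
      1/2.\<close>
    from O_P_mult_powr[OF this root_n_consistent]
    have 1: "O_P M (\<lambda>n \<omega>. norm (?H n \<omega> + I0) * norm (?d n \<omega>)) (\<lambda>n. real n powr (- 2 * g))"
      by (rule O_P_powr_mono[rotated 2]) (use g in simp_all)
    have 2: "O_P M (\<lambda>n \<omega>. \<Lambda> n \<omega> * (norm (?d n \<omega>) * norm (?d n \<omega>))) (\<lambda>n. real n powr (- 2 * g))"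
      by (rule O_P_powr_mono[OF O_P_mult_powr[OF \<Lambda>_powr
            O_P_mult_powr[OF root_n_consistent root_n_consistent]]])
        (use \<Lambda>_nonneg g in simp_all)
    have B: "O_P M (\<lambda>n \<omega>. ?B n \<omega>) (\<lambda>n. real n powr (- 2 * g))"
      by (intro O_P_add 1 2 G1)
    obtain c where c: "c > 0"
        "\<And>A x. norm (A - I0) < c \<Longrightarrow> c * norm (matrix_inv A *v x) \<le> norm x"
      by (rule invertible_perturbation[OF nonsingular]) blast
    have B': "O_P M (\<lambda>n \<omega>. real n powr (1/2) * (1 / c * ?B n \<omega>)) (\<lambda>n. real n powr (1/2 + - 2 * g))"
      using \<Lambda>_nonneg c(1)
      by (intro O_P_mult_powr O_P_of_rate O_P_cmult B) (auto intro!: add_nonneg_nonneg mult_nonneg_nonneg)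
    have pos: "whp M (\<lambda>n \<omega>. n > 0)"
      by (rule whp_eventually) (use eventually_gt_at_top[of 0] in eventually_elim, simp)
    have bound: "whp M (\<lambda>n \<omega>. norm (sqrt n *\<^sub>R ?d n \<omega>
        - (1 / sqrt n) *\<^sub>R (\<Sum>i<n. matrix_inv I0 *v ell (X i \<omega>)))
        \<le> real n powr (1/2) * (1 / c * ?B n \<omega>))"
      using whp_conj[OF pos S_derivs] score_linearization
    proof (rule whp_mono2)
      fix n \<omega>
      assume *: "n > 0 \<and> grad (S n \<omega>) \<theta>0 = (\<Sum>i<n. ell (X i \<omega>))
          \<and> hess (S n \<omega>) \<theta>0 = (\<Sum>i<n. hess (lfs (X i \<omega>)) \<theta>0)"
        and lin: "norm (ell_hat n (Shat n \<omega>) \<theta>0 + ?H n \<omega> *v ?d n \<omega>) \<le> \<Lambda> n \<omega> * (norm (?d n \<omega>))\<^sup>2"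
      \<comment> \<open>The error before inversion of \<open>I0\<close>:
        \<open>matrix_inv I0\<close> maps it to \<theta>hat - \<theta>0 minus the average of the
        terms \<open>matrix_inv I0 *v ell (X i \<omega>)\<close>.\<close>
      let ?e = "I0 *v ?d n \<omega> - grad (S n \<omega>) \<theta>0 /\<^sub>R n"
      have tri: "norm (x - y + z) \<le> norm x + norm y + norm z" for x y z :: "real ^ 'd"
        using norm_triangle_ineq[of "x - y" z] norm_triangle_ineq4[of x y] by linarith
      have e_eq: "?e = (?H n \<omega> + I0) *v ?d n \<omega> - (ell_hat n (Shat n \<omega>) \<theta>0 + ?H n \<omega> *v ?d n \<omega>) + ?U n \<omega>"
        by (simp add: matrix_vector_mult_add_rdistrib ell_hat_def)
      have "norm ?e \<le> norm ((?H n \<omega> + I0) *v ?d n \<omega>)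
          + norm (ell_hat n (Shat n \<omega>) \<theta>0 + ?H n \<omega> *v ?d n \<omega>) + norm (?U n \<omega>)"
        by (subst e_eq) (rule tri)
      also have "norm ((?H n \<omega> + I0) *v ?d n \<omega>) \<le> norm (?H n \<omega> + I0) * norm (?d n \<omega>)"
        by (rule norm_matrix_vector_mult_le)
      finally have e: "norm ?e \<le> ?B n \<omega>" using lin by (simp add: power2_eq_square)
      have "c * norm (matrix_inv I0 *v ?e) \<le> norm ?e" using c by (intro c(2)) simp
      with e have e': "norm (matrix_inv I0 *v ?e) \<le> 1 / c * ?B n \<omega>"
        using c(1) by (simp add: field_simps)
      have "(1 / sqrt n) *\<^sub>R (\<Sum>i<n. matrix_inv I0 *v ell (X i \<omega>))
          = (1 / sqrt n) *\<^sub>R (matrix_inv I0 *v grad (S n \<omega>) \<theta>0)"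
        using * by (simp add: linear_sum[OF matrix_vector_mul_linear])
      also have "\<dots> = sqrt n *\<^sub>R (matrix_inv I0 *v (grad (S n \<omega>) \<theta>0 /\<^sub>R n))"
        using * by (simp add: matrix_vector_mult_scaleR real_div_sqrt field_simps)
      finally have "sqrt n *\<^sub>R ?d n \<omega> - (1 / sqrt n) *\<^sub>R (\<Sum>i<n. matrix_inv I0 *v ell (X i \<omega>))
          = sqrt n *\<^sub>R (matrix_inv I0 *v ?e)"
        using nonsingular
        by (simp add: matrix_vector_mult_diff_distrib matrix_vector_inv_mult scaleR_diff_right)
      then have "norm (sqrt n *\<^sub>R ?d n \<omega> - (1 / sqrt n) *\<^sub>R (\<Sum>i<n. matrix_inv I0 *v ell (X i \<omega>)))
          = sqrt n * norm (matrix_inv I0 *v ?e)"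
        by (simp only: norm_scaleR) simp
      also have "\<dots> \<le> sqrt n * (1 / c * ?B n \<omega>)"
        by (intro mult_left_mono e') simp
      finally show "norm (sqrt n *\<^sub>R ?d n \<omega> - (1 / sqrt n) *\<^sub>R (\<Sum>i<n. matrix_inv I0 *v ell (X i \<omega>)))
          \<le> real n powr (1/2) * (1 / c * ?B n \<omega>)"
        by (simp add: powr_half_sqrt)
    qed
    have "O_P M (\<lambda>n \<omega>. norm (sqrt n *\<^sub>R (\<theta>hat n \<omega> - \<theta>0)
      - (1 / sqrt n) *\<^sub>R (\<Sum>i<n. matrix_inv I0 *v ell (X i \<omega>)))) (\<lambda>n. real n powr (1/2 + - 2 * g))"
      using B' by (rule O_P_mono) (use bound in simp)
    then show ?thesis by simp
  qed

  \<comment> \<open>Rates of the iterates\<close>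
  have rates: "(\<forall>k. O_P M
            (\<lambda>n \<omega>. norm (iterate I_hat_hess n (Shat n \<omega>) (\<theta>init n \<omega>) k - \<theta>hat n \<omega>))
            (\<lambda>n. real n powr (- (2 ^ k * \<psi>))))
        \<and> increases_to_infinity_from (\<lambda>k. 2 ^ k * \<psi>) \<psi>
        \<and> o_P M
            (\<lambda>n \<omega>. norm (iterate I_hat_hess n (Shat n \<omega>) (\<theta>init n \<omega>)
               (int_gt (ln (1 / (2 * \<psi>)) / ln 2)) - \<theta>hat n \<omega>))
            (\<lambda>n. real n powr (- 1/2))
        \<and> (\<forall>t1 t2. t1 < t2 \<longrightarrow>
            (\<forall>k. O_P M
              (\<lambda>n \<omega>. norm (iterate (I_hat_diff t1 t2) n (Shat n \<omega>) (\<theta>init n \<omega>) k - \<theta>hat n \<omega>))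
              (\<lambda>n. real n powr (- R \<psi> g k)))
            \<and> o_P M
              (\<lambda>n \<omega>. norm (iterate (I_hat_diff t1 t2) n (Shat n \<omega>) (\<theta>init n \<omega>) (L1_tilde \<psi> g)
                 - \<theta>hat n \<omega>))
              (\<lambda>n. real n powr (- 1/2)))
        \<and> increases_to_infinity_from (R \<psi> g) \<psi>"
    if \<psi>: "1/2 - g < \<psi>" "\<psi> \<le> 1/2"
      and init: "O_P M (\<lambda>n \<omega>. norm (\<theta>init n \<omega> - \<theta>0)) (\<lambda>n. real n powr (- \<psi>))"
    for \<psi> and \<theta>init :: "nat \<Rightarrow> 'w \<Rightarrow> real ^ 'd"
  proof (intro conjI allI impI)
    have \<psi>_pos: "\<psi> > 0" using \<psi> g by simp
    have g_pos: "g > 0" using g by simp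
    show I: "O_P M (\<lambda>n \<omega>. norm (iterate I_hat_hess n (Shat n \<omega>) (\<theta>init n \<omega>) k - \<theta>hat n \<omega>))
        (\<lambda>n. real n powr (- (2 ^ k * \<psi>)))" for k
      \<comment> \<open>The defect vanishes, so any q is allowed; q = r turns r + q into 2 r, and
        the quadratic remainder alone determines the rate.\<close>
      by (rule iterate_rate[OF init \<psi>(2) I_hat_hess_rate, where r = "\<lambda>k. 2 ^ k * \<psi>" and q = "\<lambda>k. 2 ^ k * \<psi>"])
        (use \<psi>_pos in auto)
    show "increases_to_infinity_from (\<lambda>k. 2 ^ k * \<psi>) \<psi>"
    proof (rule increases_to_infinity_fromI[OF _ \<psi>_pos])
      fix k :: nat
      have "1 * \<psi> \<le> 2 ^ k * \<psi>" using \<psi>_pos by (intro mult_right_mono) auto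
      then show "2 ^ k * \<psi> + \<psi> \<le> 2 ^ Suc k * \<psi>" by (simp add: mult.commute)
    qed simp
    show "o_P M (\<lambda>n \<omega>. norm (iterate I_hat_hess n (Shat n \<omega>) (\<theta>init n \<omega>)
        (int_gt (ln (1 / (2 * \<psi>)) / ln 2)) - \<theta>hat n \<omega>)) (\<lambda>n. real n powr (- 1/2))"
    proof (rule O_P_powr_imp_o_P[OF I])
      show "- (2 ^ int_gt (ln (1 / (2 * \<psi>)) / ln 2) * \<psi>) < - 1/2"
        using int_gt_ln[of "1 / (2 * \<psi>)"] \<psi>_pos by (simp add: pos_divide_less_eq mult_ac)
    qed
    fix t1 t2 :: real assume t: "t1 < t2"
    show II: "O_P M (\<lambda>n \<omega>. norm (iterate (I_hat_diff t1 t2) n (Shat n \<omega>) (\<theta>init n \<omega>) k - \<theta>hat n \<omega>))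
        (\<lambda>n. real n powr (- R \<psi> g k))" for k
    proof (rule iterate_rate[OF init \<psi>(2) I_hat_diff_rate[OF _ t]])
      \<comment> \<open>The defect has rate 1/2, while \<open>R\<close> grows by at most g \<le> 1/2
        in one step.\<close>
      show "R \<psi> g (Suc k) \<le> R \<psi> g k + 1/2" for k
        using R_step(2)[OF g_pos g(2) \<psi>, of k] g(2) by simp
    qed (use R_0[OF g_pos g(2) \<psi>] R_pos[OF g_pos g(2) \<psi>] R_Suc_le_double[OF g_pos g(2) \<psi>] in auto)
    show "o_P M (\<lambda>n \<omega>. norm (iterate (I_hat_diff t1 t2) n (Shat n \<omega>) (\<theta>init n \<omega>) (L1_tilde \<psi> g)
        - \<theta>hat n \<omega>)) (\<lambda>n. real n powr (- 1/2))"
      by (rule O_P_powr_imp_o_P[OF II]) (use R_L1_tilde[OF g_pos g(2) \<psi>] in simp)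
  next
    show "increases_to_infinity_from (R \<psi> g) \<psi>"
      using g by (intro R_increases \<psi>) auto
  qed
  show ?thesis
    using expansion rates by blast
qed

end
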